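(* Let $\mathcal{A}$ be a Banach algebra such that $\mathrm{rad}(\mathcal{A})=\mathrm{rann}(\mathcal{A})$ and $\mathcal{A}/\mathrm{rad}(\mathcal{A})$ is commutative, and suppose $\mathcal{A}$ has a right identity. Let $(\delta,d)$ be a generalized derivation of $\mathcal{A}$ and $k\in\mathbb{N}$. Then the following are equivalent: (i) $\delta$ is $k$-commuting; (ii) $\delta$ is $k$-centralizing; (iii) $\delta$ is a right multiplier; (iv) there exists $b\in\mathcal{A}$ such that $\delta=R_b$.
   Context: $\mathrm{rad}(\mathcal{A})$ is the Jacobson radical and $\mathrm{rann}(\mathcal{A})=\{c\in\mathcal{A}: ac=0\ \forall a\in\mathcal{A}\}$. A derivation is a linear map $d$ with $d(ab)=d(a)b+ad(b)$; a generalized derivation $(\delta,d)$ is a linear $\delta$ with a derivation $d$ such that $\delta(ab)=a\delta(b)+d(a)b$. $Z(\mathcal{A})$ is the center, $[a,b]=ab-ba$; $T$ is $k$-centralizing (resp. $k$-commuting) if $[T(a),a^k]\in Z(\mathcal{A})$ (resp. $=0$) for all $a$. A right multiplier is a linear $T$ with $T(ab)=aT(b)$ for all $a,b$; $R_b(a)=ab$. *)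

theory Defs
  imports "HOL-Analysis.Analysis"
begin

text \<open>A complex Banach algebra is encoded as a real Banach algebra
(type class real_normed_algebra + banach) together with an operator J
playing the role of multiplication by the imaginary unit i.
Complex scalar multiplication is then  c . x = Re c x + Im c J x.\<close>

definition scC :: "('a::real_vector \<Rightarrow> 'a) \<Rightarrow> complex \<Rightarrow> 'a \<Rightarrow> 'a" where
  "scC J c x = Re c *\<^sub>R x + Im c *\<^sub>R J x"

definition complex_banach_structure :: "('a::{real_normed_algebra,banach} \<Rightarrow> 'a) \<Rightarrow> bool" where
  "complex_banach_structure J \<longleftrightarrow>
     linear J \<and> (\<forall>x. J (J x) = - x) \<and>
     (\<forall>x y. J (x * y) = J x * y \<and> J (x * y) = x * J y) \<and>
     (\<forall>c x. norm (scC J c x) = cmod c * norm x)"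

definition clinear_J :: "('a::real_vector \<Rightarrow> 'a) \<Rightarrow> ('a \<Rightarrow> 'a) \<Rightarrow> bool" where
  "clinear_J J T \<longleftrightarrow> linear T \<and> (\<forall>x. T (J x) = J (T x))"

text \<open>Jacobson radical of a (possibly non-unital) ring: a is in the radical iff
the left ideal generated by a, namely {n a + b a}, consists of left quasi-regular
elements.\<close>
definition left_quasi_regular :: "'a::ring \<Rightarrow> bool" where
  "left_quasi_regular a \<longleftrightarrow> (\<exists>c. c + a - c * a = 0)"

definition rad :: "'a::{ring,real_vector} set" where
  "rad = {a. \<forall>b. \<forall>n::int. left_quasi_regular (of_int n *\<^sub>R a + b * a)}"

definition rann :: "'a::ring set" where
  "rann = {c. \<forall>a. a * c = 0}"

definition center :: "'a::ring set" where
  "center = {z. \<forall>a. z * a = a * z}"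

definition commutator :: "'a::ring \<Rightarrow> 'a \<Rightarrow> 'a" where
  "commutator a b = a * b - b * a"

text \<open>Positive powers in a non-unital algebra: apow a n = a^(n+1); npow a k = a^k for k >= 1.\<close>
primrec apow :: "'a::ring \<Rightarrow> nat \<Rightarrow> 'a" where
  "apow a 0 = a"
| "apow a (Suc n) = a * apow a n"

definition npow :: "'a::ring \<Rightarrow> nat \<Rightarrow> 'a" where
  "npow a k = apow a (k - 1)"

definition is_derivation :: "('a::{ring,real_vector} \<Rightarrow> 'a) \<Rightarrow> ('a \<Rightarrow> 'a) \<Rightarrow> bool" where
  "is_derivation J d \<longleftrightarrow> clinear_J J d \<and> (\<forall>a b. d (a * b) = d a * b + a * d b)"

definition is_generalized_derivation ::
  "('a::{ring,real_vector} \<Rightarrow> 'a) \<Rightarrow> ('a \<Rightarrow> 'a) \<Rightarrow> ('a \<Rightarrow> 'a) \<Rightarrow> bool" where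
  "is_generalized_derivation J \<delta> d \<longleftrightarrow> clinear_J J \<delta> \<and> is_derivation J d \<and>
     (\<forall>a b. \<delta> (a * b) = a * \<delta> b + d a * b)"

definition k_commuting :: "nat \<Rightarrow> ('a::ring \<Rightarrow> 'a) \<Rightarrow> bool" where
  "k_commuting k T \<longleftrightarrow> (\<forall>a. commutator (T a) (npow a k) = 0)"

definition k_centralizing :: "nat \<Rightarrow> ('a::ring \<Rightarrow> 'a) \<Rightarrow> bool" where
  "k_centralizing k T \<longleftrightarrow> (\<forall>a. commutator (T a) (npow a k) \<in> center)"

definition right_multiplier :: "('a::{ring,real_vector} \<Rightarrow> 'a) \<Rightarrow> ('a \<Rightarrow> 'a) \<Rightarrow> bool" where
  "right_multiplier J T \<longleftrightarrow> clinear_J J T \<and> (\<forall>a b. T (a * b) = a * T b)"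

definition R_mult :: "'a::ring \<Rightarrow> 'a \<Rightarrow> 'a" where
  "R_mult b = (\<lambda>a. a * b)"

end

theory Submission
  imports Defs
begin

text \<open>Since \<open>\<delta> a = a * \<delta> e + d a\<close> for a right identity \<open>e\<close>, everything comes down to \<open>d = 0\<close>.
  The quotient by \<open>rad = rann\<close> is a commutative semisimple unital Banach algebra, so \<open>d\<close> maps into
  \<open>rann\<close> by the theorems of Johnson and Singer--Wermer. They are proved here without forming the
  quotient, through the characters of \<open>A\<close>, whose common kernel is \<open>rann\<close>. First, only finitely many
  characters are non-zero on the separating space of \<open>d\<close>, and an idempotent argument excludes
  these too, so \<open>d\<close> is bounded modulo \<open>rann\<close> by the closed graph theorem. Then
  \<open>m! * \<phi> (d a) ^ m = \<phi> ((d ^^ m) (a ^ m))\<close> for \<open>\<phi> a = 0\<close> grows at most geometrically, so \<open>\<phi> (d a) = 0\<close>.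
  Finally, \<open>d a \<in> rann\<close> turns the centralizing condition into \<open>d a * a ^ k = 0\<close>, and evaluating at
  \<open>e + t a\<close> as \<open>t\<close> tends to \<open>0\<close> gives \<open>d a = 0\<close>.\<close>

section \<open>Banach space preliminaries\<close>

text \<open>By Baire, the closure of some sublevel set of \<open>norm (f x)\<close> contains a ball.
  Scaled differences of sublevel points then approximate every \<open>x\<close> with controlled
  images, and the graph hypothesis identifies the sum of the images of successive corrections with
  \<open>f x\<close>.\<close>

lemma closed_graph_bounded_linear:
  fixes f :: "'a::banach \<Rightarrow> 'b::banach"
  assumes lin: "linear f"
    and graph: "\<And>X x y. X \<longlonglongrightarrow> x \<Longrightarrow> (\<lambda>n. f (X n)) \<longlonglongrightarrow> y \<Longrightarrow> f x = y"
  shows "bounded_linear f"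
proof -
  interpret f: linear f by (rule lin)
  define B where "B = (\<lambda>n::nat. closure {x. norm (f x) \<le> real n})"
  have "\<exists>n. interior (B n) \<noteq> {}"
  proof (rule ccontr)
    assume *: "\<not> ?thesis"
    have "euclidean interior_of \<Union> (range B) = {}"
    proof (rule Baire_category_alt)
      have "completely_metrizable_space (euclidean::'a topology)"
        unfolding completely_metrizable_space_def
        by (metis Met_TC.Metric_space_axioms complete_UNIV mcomplete_iff_complete
            mtopology_is_euclidean)
      then show "completely_metrizable_space (euclidean::'a topology) \<or>
         locally_compact_space (euclidean::'a topology) \<and> regular_space (euclidean::'a topology)" ..
    qed (use * in \<open>auto simp: B_def interior_of_def interior_def\<close>)
    moreover have "\<Union> (range B) = UNIV"
    proof -
      have "x \<in> B (nat \<lceil>norm (f x)\<rceil>)" for x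
        unfolding B_def by (rule closure_subset[THEN subsetD]) (simp add: real_nat_ceiling_ge)
      then show ?thesis by blast
    qed
    ultimately show False by simp
  qed
  then obtain n x0 r where r: "r > 0" and ball: "ball x0 r \<subseteq> B n"
    by (meson ex_in_conv mem_interior)
  \<comment> \<open>With \<open>t = r / (2 * norm x)\<close>, the difference of two sublevel points
    scaled by \<open>1/t\<close> has image of norm at most \<open>2 * n / t\<close>, which is
    \<open>4 * n * norm x / r\<close>.\<close>
  define K where "K = 4 * real n / r"
  have approx: "\<exists>y. norm (x - y) \<le> \<epsilon> \<and> norm (f y) \<le> K * norm x" if "\<epsilon> > 0" for x \<epsilon>
  proof (cases "x = 0")
    case True
    then show ?thesis using that by (intro exI[of _ 0]) (simp add: f.zero)
  next
    case False
    define t where "t = r / (2 * norm x)"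
    have t: "t > 0" using r False by (simp add: t_def)
    have "norm (t *\<^sub>R x) < r" using r False by (simp add: t_def)
    then have x0x: "x0 + t *\<^sub>R x \<in> B n" using ball by (auto simp: dist_norm)
    have x0: "x0 \<in> B n" using ball r by auto
    have te: "t * \<epsilon> / 2 > 0" using t that by simp
    obtain u where u: "norm (f u) \<le> n" "dist u (x0 + t *\<^sub>R x) < t * \<epsilon> / 2"
      using x0x te unfolding B_def closure_approachable by blast
    obtain v where v: "norm (f v) \<le> n" "dist v x0 < t * \<epsilon> / 2"
      using x0 te unfolding B_def closure_approachable by blast
    define y where "y = (1/t) *\<^sub>R (u - v)"
    have "x - y = (1/t) *\<^sub>R ((x0 + t *\<^sub>R x - u) - (x0 - v))"
      using t by (simp add: y_def algebra_simps)
    then have "norm (x - y) = norm ((x0 + t *\<^sub>R x - u) - (x0 - v)) / t"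
      using t by simp
    moreover have "norm ((x0 + t *\<^sub>R x - u) - (x0 - v)) \<le> t * \<epsilon>"
      using u(2) v(2) norm_triangle_ineq4[of "x0 + t *\<^sub>R x - u" "x0 - v"]
      by (simp add: dist_norm norm_minus_commute)
    ultimately have "norm (x - y) \<le> \<epsilon>"
      using t by (simp add: divide_le_eq mult.commute)
    moreover have "norm (f y) \<le> (1/t) * (n + n)"
      using t u(1) v(1) norm_triangle_ineq4[of "f u" "f v"]
      by (simp add: y_def f.scaleR f.diff divide_right_mono)
    moreover have "(1/t) * (real n + n) = K * norm x"
      using r False by (simp add: t_def K_def field_simps)
    ultimately show ?thesis by auto
  qed
  have K0: "K \<ge> 0" using r by (simp add: K_def)
  have bound: "norm (f x) \<le> norm x * (2 * K)" for x
  proof (cases "x = 0")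
    case True
    then show ?thesis by (simp add: f.zero)
  next
    case False
    \<comment> \<open>\<open>h n x'\<close> approximates the current remainder \<open>x'\<close>;
      \<open>X n\<close> is what remains of \<open>x\<close> after \<open>n\<close> corrections, and
      the bound on its norm halves at each step.\<close>
    define h where "h = (\<lambda>n x'. SOME y. norm (x' - y) \<le> norm x / 2 ^ Suc n \<and> norm (f y) \<le> K * norm x')"
    define X where "X = rec_nat x (\<lambda>n x'. x' - h n x')"
    have X0: "X 0 = x" and XS: "X (Suc n) = X n - h n (X n)" for n by (auto simp: X_def)
    have h: "norm (x' - h n x') \<le> norm x / 2 ^ Suc n \<and> norm (f (h n x')) \<le> K * norm x'" for n x'
      unfolding h_def by (rule someI_ex, rule approx) (use False in simp)
    have nX: "norm (X n) \<le> norm x / 2 ^ n" for n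
      by (cases n) (use h X0 XS in auto)
    have "X \<longlonglongrightarrow> 0"
    proof (rule Lim_null_comparison)
      show "\<forall>\<^sub>F n in sequentially. norm (X n) \<le> norm x * (1/2) ^ n"
        using nX by (simp add: power_divide)
      show "(\<lambda>n. norm x * (1/2) ^ n) \<longlonglongrightarrow> 0"
        by (intro tendsto_mult_right_zero LIMSEQ_power_zero) simp
    qed
    have nf: "norm (f (h n (X n))) \<le> K * norm x * (1/2) ^ n" for n
    proof -
      have "norm (f (h n (X n))) \<le> K * norm (X n)" using h by blast
      also have "\<dots> \<le> K * (norm x / 2 ^ n)" by (intro mult_left_mono nX K0)
      finally show ?thesis by (simp add: power_divide)
    qed
    have geo: "summable (\<lambda>n. K * norm x * (1/2::real) ^ n)"
      by (intro summable_mult summable_geometric) simp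
    have sm: "summable (\<lambda>n. norm (f (h n (X n))))"
      by (rule summable_comparison_test[OF _ geo]) (use nf in auto)
    define s where "s = (\<Sum>n. f (h n (X n)))"
    have part: "(\<Sum>i<n. f (h i (X i))) = f (x - X n)" for n
      by (induction n) (auto simp: X0 XS f.diff f.zero)
    have "(\<lambda>n. f (x - X n)) \<longlonglongrightarrow> s"
      using summable_LIMSEQ[OF summable_norm_cancel[OF sm]] by (simp add: s_def part)
    moreover have "(\<lambda>n. x - X n) \<longlonglongrightarrow> x"
      using tendsto_diff[OF tendsto_const \<open>X \<longlonglongrightarrow> 0\<close>, of x] by simp
    ultimately have "f x = s" by (rule graph[rotated])
    also have "norm s \<le> (\<Sum>n. norm (f (h n (X n))))"
      unfolding s_def by (rule summable_norm[OF sm])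
    also have "\<dots> \<le> (\<Sum>n. K * norm x * (1/2) ^ n)"
      by (rule suminf_le[OF nf sm geo])
    also have "\<dots> = K * norm x * 2"
      by (subst suminf_mult) (auto simp: suminf_geometric)
    finally show ?thesis by (simp add: mult_ac)
  qed
  show ?thesis
    by (rule bounded_linear_intro[OF _ _ bound]) (simp_all add: f.add f.scaleR)
qed

section \<open>Powers, quasi-inverses and complex scalars\<close>

lemma norm_apow_le:
  fixes y :: "'a::real_normed_algebra"
  shows "norm (apow y n) \<le> norm y ^ Suc n"
proof (induction n)
  case (Suc n)
  have "norm (apow y (Suc n)) \<le> norm y * norm (apow y n)" by (simp add: norm_mult_ineq)
  also have "\<dots> \<le> norm y * norm y ^ Suc n" by (intro mult_left_mono Suc) auto
  finally show ?case by simp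
qed simp

lemma apow_commute: "apow y n * y = y * apow y n"
  by (induction n) (auto simp: mult.assoc)

lemma neumann_quasi_inverse:
  fixes y :: "'a::{real_normed_algebra,banach}"
  assumes "norm y < 1"
  obtains z where "z = y + y * z" "z = y + z * y"
proof -
  have geo: "summable (\<lambda>n. norm y ^ Suc n)"
    using assms by (simp only: summable_Suc_iff) (simp add: summable_geometric)
  have sm: "summable (apow y)"
    by (rule summable_comparison_test[OF _ geo]) (use norm_apow_le in auto)
  define z where "z = suminf (apow y)"
  have "suminf (\<lambda>n. apow y (Suc n)) = z - y"
    using suminf_split_head[OF sm] by (simp add: z_def)
  moreover have "suminf (\<lambda>n. apow y (Suc n)) = y * z"
    using suminf_mult[OF sm, of y] by (simp add: z_def)
  moreover have "suminf (\<lambda>n. apow y (Suc n)) = z * y"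
    using suminf_mult2[OF sm, of y] by (simp add: z_def apow_commute)
  ultimately show thesis by (intro that[of z]) (auto simp: algebra_simps)
qed

lemma complex_banach_structureD:
  assumes "complex_banach_structure J"
  shows "linear J" "J (J x) = - x" "J x * y = J (x * y)" "x * J y = J (x * y)"
    "norm (scC J c x) = cmod c * norm x"
  using assms unfolding complex_banach_structure_def by metis+

locale complex_banach_algebra =
  fixes J :: "'a::{real_normed_algebra,banach} \<Rightarrow> 'a"
  assumes struct: "complex_banach_structure J"
begin

lemmas J_simps = complex_banach_structureD(2-4)[OF struct]
  linear_add[OF complex_banach_structureD(1)[OF struct]]
  linear_diff[OF complex_banach_structureD(1)[OF struct]]
  linear_neg[OF complex_banach_structureD(1)[OF struct]]
  linear_cmul[OF complex_banach_structureD(1)[OF struct]]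
  linear_0[OF complex_banach_structureD(1)[OF struct]]

abbreviation sc where "sc \<equiv> scC J"

lemma norm_sc: "norm (sc c x) = cmod c * norm x"
  by (rule complex_banach_structureD(5)[OF struct])

lemma sc_add: "sc c (x + y) = sc c x + sc c y"
  and sc_diff: "sc c (x - y) = sc c x - sc c y"
  and sc_add_left: "sc (c + c') x = sc c x + sc c' x"
  and sc_diff_left: "sc (c - c') x = sc c x - sc c' x"
  and sc_sc: "sc c (sc c' x) = sc (c * c') x"
  and sc_one: "sc 1 x = x"
  and mult_sc_right: "x * sc c y = sc c (x * y)"
  and mult_sc_left: "sc c x * y = sc c (x * y)"
  by (simp_all add: scC_def J_simps algebra_simps)

lemma sc_zero [simp]: "sc c 0 = 0" "sc 0 x = 0"
  by (simp_all add: scC_def J_simps)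

lemma sc_of_real: "sc (of_real r) x = r *\<^sub>R x"
  by (simp add: scC_def)

end

section \<open>Maximal ideals and the Gelfand--Mazur theorem\<close>

text \<open>\<open>right_commute\<close> says that commutators lie in \<open>rann\<close>:
  commutativity of the quotient, stated inside the algebra.\<close>

locale right_unital_algebra = complex_banach_algebra J
  for J :: "'a::{real_normed_algebra,banach} \<Rightarrow> 'a" +
  fixes e :: 'a
  assumes right_unit: "x * e = x"
    and right_commute: "x * y * z = x * z * y"
begin

lemma commutator_in_rann: "x * y - y * x \<in> rann" for x y :: 'a
  by (simp add: rann_def right_diff_distrib mult.assoc[symmetric] right_commute[of _ x y])

lemma diff_unit_mult_in_rann: "x - e * x \<in> rann"
  by (simp add: rann_def right_diff_distrib mult.assoc[symmetric] right_unit)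

text \<open>Containing \<open>rann\<close> makes these the preimages of ideals of the quotient by
  \<open>rann\<close>. Stability under right multiplication and complex scalars follows
  below.\<close>

definition left_ideal :: "'a set \<Rightarrow> bool" where
  "left_ideal M \<longleftrightarrow> rann \<subseteq> M \<and> (\<forall>x\<in>M. \<forall>y\<in>M. x - y \<in> M) \<and> (\<forall>a. \<forall>x\<in>M. a * x \<in> M)"

text \<open>Maximality is expressed by its consequence that every non-zero class modulo
  \<open>M\<close> is invertible.\<close>

definition maximal_ideal :: "'a set \<Rightarrow> bool" where
  "maximal_ideal M \<longleftrightarrow> left_ideal M \<and> e \<notin> M \<and> (\<forall>x. x \<notin> M \<longrightarrow> (\<exists>y. e - y * x \<in> M))"

lemma left_ideal_zero: "left_ideal M \<Longrightarrow> 0 \<in> M"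
  by (auto simp: left_ideal_def rann_def)

lemma left_ideal_diff: "left_ideal M \<Longrightarrow> x \<in> M \<Longrightarrow> y \<in> M \<Longrightarrow> x - y \<in> M"
  by (auto simp: left_ideal_def)

lemma left_ideal_add:
  assumes "left_ideal M" "x \<in> M" "y \<in> M"
  shows "x + y \<in> M"
proof -
  have "x - (0 - y) \<in> M"
    using assms left_ideal_zero[OF assms(1)] unfolding left_ideal_def by blast
  then show ?thesis by simp
qed

lemma left_ideal_mult: "left_ideal M \<Longrightarrow> x \<in> M \<Longrightarrow> a * x \<in> M"
  by (auto simp: left_ideal_def)

lemma left_ideal_mult_right:
  assumes "left_ideal M" "x \<in> M"
  shows "x * a \<in> M"
proof -
  have "a * x + (x * a - a * x) \<in> M"
    using assms commutator_in_rann[of x a]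
    by (intro left_ideal_add left_ideal_mult) (auto simp: left_ideal_def)
  then show ?thesis by simp
qed

text \<open>\<open>e\<close> is only a right unit, but \<open>x - e * x\<close> lies in
  \<open>rann\<close>. Behind a factor \<open>e\<close> all other factors can be permuted by
  \<open>right_commute\<close>, so later memberships are checked there and transferred back by this
  lemma.\<close>

lemma left_ideal_unit_multD:
  assumes "left_ideal M" "e * x \<in> M"
  shows "x \<in> M"
proof -
  have "e * x + (x - e * x) \<in> M"
    using assms diff_unit_mult_in_rann[of x]
    by (intro left_ideal_add) (auto simp: left_ideal_def)
  then show ?thesis by simp
qed

lemma left_ideal_sc:
  assumes "left_ideal M" "x \<in> M"
  shows "sc c x \<in> M"
proof (rule left_ideal_unit_multD[OF assms(1)])
  have "sc c e * x \<in> M" by (rule left_ideal_mult[OF assms])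
  then show "e * sc c x \<in> M" by (simp add: mult_sc_left mult_sc_right)
qed

lemma left_ideal_extend:
  assumes "left_ideal M"
  shows "left_ideal {a * x + m | a m. m \<in> M}" (is "left_ideal ?N")
    and "M \<subseteq> {a * x + m | a m. m \<in> M}" and "x \<in> {a * x + m | a m. m \<in> M}"
proof -
  show sub: "M \<subseteq> ?N"
    by clarsimp (metis add_0 mult_zero_left)
  have "u - v \<in> ?N" if uv: "u \<in> ?N" "v \<in> ?N" for u v
  proof -
    obtain a m b n where *: "u = a * x + m" "v = b * x + n" "m \<in> M" "n \<in> M"
      using uv by blast
    then have "u - v = (a - b) * x + (m - n)" by (simp add: algebra_simps)
    then show ?thesis using left_ideal_diff[OF assms *(3,4)] by blast
  qed
  moreover have "b * u \<in> ?N" if u: "u \<in> ?N" for u b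
  proof -
    obtain a m where *: "u = a * x + m" "m \<in> M"
      using u by blast
    then have "b * u = (b * a) * x + b * m" by (simp add: algebra_simps)
    then show ?thesis using left_ideal_mult[OF assms *(2)] by blast
  qed
  ultimately show "left_ideal ?N"
    using assms sub unfolding left_ideal_def by blast
  have "x - e * x \<in> M"
    using assms diff_unit_mult_in_rann by (auto simp: left_ideal_def)
  moreover have "x = e * x + (x - e * x)" by simp
  ultimately show "x \<in> ?N" by blast
qed

lemma maximal_ideal_exists:
  assumes I: "left_ideal I" "e \<notin> I"
  obtains M where "maximal_ideal M" "I \<subseteq> M"
proof -
  define A where "A = {M. left_ideal M \<and> e \<notin> M \<and> I \<subseteq> M}"
  have "\<exists>M\<in>A. \<forall>X\<in>A. M \<subseteq> X \<longrightarrow> X = M"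
  proof (rule subset_Zorn_nonempty)
    show "A \<noteq> {}" using I by (auto simp: A_def)
    fix C assume C: "C \<noteq> {}" "subset.chain A C"
    then have CA: "C \<subseteq> A" and ch: "\<And>X Y. X \<in> C \<Longrightarrow> Y \<in> C \<Longrightarrow> X \<subseteq> Y \<or> Y \<subseteq> X"
      by (auto simp: subset_chain_def)
    have "x - y \<in> \<Union>C" if xy: "x \<in> \<Union>C" "y \<in> \<Union>C" for x y
    proof -
      obtain X Y where XY: "X \<in> C" "x \<in> X" "Y \<in> C" "y \<in> Y" using xy by blast
      then obtain Z where Z: "Z \<in> C" "x \<in> Z" "y \<in> Z" using ch by blast
      then have "left_ideal Z" using CA by (auto simp: A_def)
      then show ?thesis using Z left_ideal_diff by blast
    qed
    moreover have "a * x \<in> \<Union>C" if "x \<in> \<Union>C" for a x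
      using that CA left_ideal_mult by (fastforce simp: A_def)
    moreover have "rann \<subseteq> \<Union>C" "I \<subseteq> \<Union>C" "e \<notin> \<Union>C"
    proof -
      obtain X where "X \<in> C" using C(1) by blast
      then show "rann \<subseteq> \<Union>C" "I \<subseteq> \<Union>C"
        using CA unfolding A_def left_ideal_def by blast+
    qed (use CA in \<open>auto simp: A_def\<close>)
    ultimately show "\<Union>C \<in> A" by (auto simp: A_def left_ideal_def)
  qed
  then obtain M where M: "left_ideal M" "e \<notin> M" "I \<subseteq> M"
    and max: "\<And>X. left_ideal X \<Longrightarrow> e \<notin> X \<Longrightarrow> M \<subseteq> X \<Longrightarrow> X = M"
    by (auto simp: A_def)
  \<comment> \<open>The ideal generated by \<open>M\<close> and \<open>x\<close> is strictly larger,
    so it contains \<open>e\<close>; this exhibits an inverse of \<open>x\<close> modulo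
    \<open>M\<close>.\<close>
  have "\<exists>y. e - y * x \<in> M" if x: "x \<notin> M" for x
  proof -
    have "e \<in> {a * x + m | a m. m \<in> M}"
      using max[OF left_ideal_extend(1)[OF M(1)]] left_ideal_extend(2,3)[OF M(1), of x] x by blast
    then obtain a m where *: "e = a * x + m" "m \<in> M" by blast
    then have "e - a * x = m" by (metis add_diff_cancel_left')
    then show ?thesis using *(2) by auto
  qed
  with M show thesis by (intro that[of M]) (auto simp: maximal_ideal_def)
qed

end

section \<open>The quotient seminorm of a maximal ideal\<close>

locale maximal_ideal_quotient = right_unital_algebra +
  fixes M
  assumes maximal: "maximal_ideal M"
begin

lemma ideal: "left_ideal M" and unit_notin: "e \<notin> M"
  and inverse_ex: "x \<notin> M \<Longrightarrow> \<exists>y. e - y * x \<in> M"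
  using maximal by (auto simp: maximal_ideal_def)

lemmas M_closed = left_ideal_diff[OF ideal] left_ideal_add[OF ideal] left_ideal_mult[OF ideal]
  left_ideal_mult_right[OF ideal] left_ideal_sc[OF ideal] left_ideal_zero[OF ideal]

lemmas M_unitD = left_ideal_unit_multD[OF ideal]

lemma M_ne: "M \<noteq> {}" using M_closed(6) by blast

text \<open>The norm of the quotient pulled back to the algebra. As \<open>M\<close> is not assumed
  closed, it is only a seminorm; \<open>p_unit_ge_1\<close> shows that it is not degenerate.\<close>

definition quotient_norm :: "'a \<Rightarrow> real" where "quotient_norm x = infdist x M"

abbreviation "p \<equiv> quotient_norm"

lemma p_nonneg: "p x \<ge> 0" by (simp add: quotient_norm_def infdist_nonneg)

lemma p_le_norm_diff: "m \<in> M \<Longrightarrow> p x \<le> norm (x - m)"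
  using infdist_le[of m M x] by (simp add: quotient_norm_def dist_norm)

lemma p_le_norm: "p x \<le> norm x"
  using p_le_norm_diff[OF M_closed(6)] by simp

lemma le_pI: "(\<And>m. m \<in> M \<Longrightarrow> c \<le> norm (x - m)) \<Longrightarrow> c \<le> p x"
  unfolding quotient_norm_def infdist_notempty[OF M_ne] by (rule cINF_greatest[OF M_ne]) (simp add: dist_norm)

lemma le_mult_pI:
  assumes "k \<ge> 0" and "\<And>m. m \<in> M \<Longrightarrow> c \<le> k * norm (x - m)"
  shows "c \<le> k * p x"
proof (cases "k = 0")
  case True
  then show ?thesis using assms(2)[OF M_closed(6)] by simp
next
  case False
  then have "c / k \<le> p x"
    using assms by (intro le_pI) (simp add: divide_le_eq mult.commute)
  then show ?thesis using False assms(1) by (simp add: divide_le_eq mult.commute)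
qed

lemma p_add: "p (x + y) \<le> p x + p y"
proof -
  have "p (x + y) - p y \<le> p x"
  proof (rule le_pI)
    fix m assume m: "m \<in> M"
    have "p (x + y) - norm (x - m) \<le> p y"
    proof (rule le_pI)
      fix n assume n: "n \<in> M"
      have "p (x + y) \<le> norm ((x - m) + (y - n))"
        using p_le_norm_diff[OF M_closed(2)[OF m n], of "x + y"] by (simp add: algebra_simps)
      also have "\<dots> \<le> norm (x - m) + norm (y - n)" by (rule norm_triangle_ineq)
      finally show "p (x + y) - norm (x - m) \<le> norm (y - n)" by simp
    qed
    then show "p (x + y) - p y \<le> norm (x - m)" by simp
  qed
  then show ?thesis by simp
qed

lemma p_mult: "p (x * y) \<le> p x * p y"
proof (rule le_mult_pI[OF p_nonneg])
  fix n assume n: "n \<in> M"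
  have "p (x * y) \<le> norm (y - n) * p x"
  proof (rule le_mult_pI)
    fix m assume m: "m \<in> M"
    have "x * y - (x - m) * (y - n) \<in> M"
    proof -
      have "x * n + m * (y - n) \<in> M" using m n by (intro M_closed)
      then show ?thesis by (simp add: algebra_simps)
    qed
    from p_le_norm_diff[OF this, of "x * y"] have "p (x * y) \<le> norm ((x - m) * (y - n))" by simp
    also have "\<dots> \<le> norm (x - m) * norm (y - n)" by (rule norm_mult_ineq)
    finally show "p (x * y) \<le> norm (y - n) * norm (x - m)" by (simp add: mult.commute)
  qed simp
  then show "p (x * y) \<le> p x * norm (y - n)" by (simp add: mult.commute)
qed

lemma p_sc: "p (sc c x) \<le> cmod c * p x"
proof (rule le_mult_pI)
  fix m assume "m \<in> M"
  from p_le_norm_diff[OF M_closed(5)[OF this, of c], of "sc c x"]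
  show "p (sc c x) \<le> cmod c * norm (x - m)" by (simp add: norm_sc flip: sc_diff)
qed simp

lemma p_cong: "x - y \<in> M \<Longrightarrow> p x \<le> p y"
  using p_add[of "x - y" y] by (simp add: quotient_norm_def)

lemma p_minus_commute: "p (x - y) = p (y - x)"
  using p_sc[of "-1" "x - y"] p_sc[of "-1" "y - x"] by (simp add: scC_def)

lemma p_triangle: "p (x - z) \<le> p (x - y) + p (y - z)"
  using p_add[of "x - y" "y - z"] by simp

text \<open>An \<open>m\<close> in \<open>M\<close> at distance below 1 from \<open>e\<close> would
  be invertible modulo \<open>M\<close>: if \<open>z\<close> is the quasi-inverse of
  \<open>e - m\<close>, then \<open>(e + z) * m\<close> becomes \<open>e\<close> after left
  multiplication by \<open>e\<close>.\<close>

lemma p_unit_ge_1: "p e \<ge> 1"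
proof (rule le_pI, rule ccontr)
  fix m assume m: "m \<in> M" and "\<not> 1 \<le> norm (e - m)"
  then have "norm (e - m) < 1" by simp
  then obtain z where z: "z = (e - m) + z * (e - m)"
    using neumann_quasi_inverse by metis
  have "(e + z) * m \<in> M" using m by (intro M_closed)
  moreover have "e * ((e + z) * m) = e * e"
  proof -
    have "z * m = e - m"
      using z right_unit[of z] by (simp add: algebra_simps)
    then show ?thesis
      by (simp add: distrib_left distrib_right right_diff_distrib mult.assoc[symmetric] right_unit)
  qed
  ultimately have "e \<in> M" by (metis M_closed(3) right_unit)
  then show False using unit_notin by contradiction
qed

end

section \<open>Resolvents modulo a maximal ideal\<close>

context maximal_ideal_quotient
begin

lemmas additive_normalize = add.assoc add.commute add.left_commute
  diff_diff_eq diff_diff_eq2 add_diff_eq diff_add_eq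

lemmas normalize = distrib_left distrib_right left_diff_distrib right_diff_distrib
  mult.assoc[symmetric] right_commute right_unit

text \<open>The resolvent identity modulo \<open>M\<close> makes the reciprocal of
  \<open>p (R l)\<close> Lipschitz in \<open>l\<close>. This positive function attains its minimum
  on the compact disc, which bounds \<open>p (R l)\<close> from above.\<close>

lemma resolvent_bounded_on_disc:
  assumes R: "\<And>l. e - R l * (a - sc l e) \<in> M" and r: "r \<ge> 0"
  obtains K where "K > 0" "\<And>l. cmod l \<le> r \<Longrightarrow> p (R l) \<le> K"
    "\<And>l m. p (R l - R m) \<le> cmod (l - m) * (p (R l) * p (R m))"
proof -
  have diff: "R l - R m - sc (l - m) (R l * R m) \<in> M" for l m
  proof (rule M_unitD)
    have "e * (R l * (e - R m * (a - sc m e)) - (e - R l * (a - sc l e)) * R m) \<in> M"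
      by (intro M_closed R)
    then show "e * (R l - R m - sc (l - m) (R l * R m)) \<in> M"
      by (simp add: normalize mult_sc_left mult_sc_right sc_diff_left additive_normalize)
  qed
  have lip: "p (R l - R m) \<le> cmod (l - m) * (p (R l) * p (R m))" for l m
  proof -
    have "p (R l - R m) \<le> p (sc (l - m) (R l * R m))"
      by (rule p_cong[OF diff])
    also have "\<dots> \<le> cmod (l - m) * p (R l * R m)" by (rule p_sc)
    also have "\<dots> \<le> cmod (l - m) * (p (R l) * p (R m))" by (intro mult_left_mono p_mult) simp
    finally show ?thesis .
  qed
  have pos: "p (R l) > 0" for l
  proof -
    have "1 \<le> p (R l * (a - sc l e))"
      using p_unit_ge_1 p_cong[OF R[of l]] by simp
    also have "\<dots> \<le> p (R l) * p (a - sc l e)" by (rule p_mult)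
    finally have "p (R l) \<noteq> 0" by auto
    then show ?thesis using p_nonneg[of "R l"] by simp
  qed
  have inv1: "1 / p (R m) - 1 / p (R l) \<le> cmod (l - m)" for l m
  proof -
    have "p (R l) \<le> p (R m) + p (R l - R m)" using p_add[of "R m" "R l - R m"] by simp
    then have "p (R l) - p (R m) \<le> cmod (l - m) * (p (R l) * p (R m))" using lip[of l m] by simp
    then have "(p (R l) - p (R m)) / (p (R l) * p (R m)) \<le> cmod (l - m)"
      using pos by (simp add: divide_le_eq)
    moreover have "(p (R l) - p (R m)) / (p (R l) * p (R m)) = 1 / p (R m) - 1 / p (R l)"
      using pos[of l] pos[of m] by (simp add: field_simps)
    ultimately show ?thesis by simp
  qed
  have "continuous_on (cball 0 r) (\<lambda>l. 1 / p (R l))"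
  proof (rule lipschitz_on_continuous_on[of 1], rule lipschitz_onI)
    fix l m
    show "dist (1 / p (R l)) (1 / p (R m)) \<le> 1 * dist l m"
      using inv1[of l m] inv1[of m l] by (simp add: dist_norm norm_minus_commute abs_le_iff)
  qed simp
  moreover have "cball (0::complex) r \<noteq> {}" using r by simp
  ultimately obtain l0 where "\<forall>l\<in>cball 0 r. 1 / p (R l0) \<le> 1 / p (R l)"
    using continuous_attains_inf[OF compact_cball] by blast
  then have "1 / p (R l0) \<le> 1 / p (R l)" if "cmod l \<le> r" for l
    using that by simp
  then have "p (R l) \<le> p (R l0)" if "cmod l \<le> r" for l
    using pos[of l] pos[of l0] that by (metis frac_le inverse_eq_divide inverse_le_imp_le)
  then show thesis using lip by (intro that[OF pos[of l0]])
qed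

text \<open>This is \<open>x\<close> to the power \<open>2 ^ k\<close>; each step in
  \<open>k\<close> squares it.\<close>

definition sqpow :: "'a \<Rightarrow> nat \<Rightarrow> 'a" where
  "sqpow x k = ((\<lambda>y. y * y) ^^ k) x"

lemma sqpow_0 [simp]: "sqpow x 0 = x" and sqpow_Suc [simp]: "sqpow x (Suc k) = sqpow x k * sqpow x k"
  by (simp_all add: sqpow_def)

text \<open>The inverse of \<open>e - l\<^sup>n x\<^sup>n\<close> is the mean of the inverses of \<open>e - \<zeta> l x\<close> over the \<open>n\<close>-th roots of
  unity \<open>\<zeta>\<close>, so one Lipschitz constant serves all \<open>n = 2\<^sup>k\<close>. This replaces Cauchy's theorem in
  Gelfand--Mazur.\<close>
lemma averaged_resolvents:
  assumes G: "\<And>l. cmod l \<le> r \<Longrightarrow> e - G l * (e - sc l x) \<in> M"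
    and lip: "\<And>l m. cmod l \<le> r \<Longrightarrow> cmod m \<le> r \<Longrightarrow> p (G l - G m) \<le> L * cmod (l - m)"
  shows "\<exists>Q. (\<forall>l. cmod l \<le> r \<longrightarrow> e - Q l * (e - sc (l ^ 2 ^ k) (sqpow x k)) \<in> M) \<and>
     (\<forall>l m. cmod l \<le> r \<longrightarrow> cmod m \<le> r \<longrightarrow> p (Q l - Q m) \<le> L * cmod (l - m))"
proof (induction k)
  case 0
  then show ?case using assms by auto
next
  case (Suc k)
  then obtain Q where
    Q: "\<And>l. cmod l \<le> r \<Longrightarrow> e - Q l * (e - sc (l ^ 2 ^ k) (sqpow x k)) \<in> M" and
    QL: "\<And>l m. cmod l \<le> r \<Longrightarrow> cmod m \<le> r \<Longrightarrow> p (Q l - Q m) \<le> L * cmod (l - m)" by blast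
  \<comment> \<open>Replacing \<open>l\<close> by \<open>l * \<zeta>\<close> flips the sign of
    \<open>y\<close> below, and the mean of the inverses of \<open>e - y\<close> and
    \<open>e + y\<close> is an inverse of \<open>e - y * y\<close>.\<close>
  define \<zeta> where "\<zeta> = cis (pi / 2 ^ k)"
  have \<zeta>: "\<zeta> ^ 2 ^ k = -1" "cmod \<zeta> = 1"
    by (simp_all add: \<zeta>_def Complex.DeMoivre)
  define Q' where "Q' l = sc (1/2) (Q l + Q (l * \<zeta>))" for l
  have "e - Q' l * (e - sc (l ^ 2 ^ Suc k) (sqpow x (Suc k))) \<in> M" if l: "cmod l \<le> r" for l
  proof (rule M_unitD)
    define y where "y = sc (l ^ 2 ^ k) (sqpow x k)"
    have yy: "sc (l ^ 2 ^ Suc k) (sqpow x (Suc k)) = y * y"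
      by (simp add: y_def mult_sc_left mult_sc_right sc_sc mult_2 power_add)
    have "sc ((l * \<zeta>) ^ 2 ^ k) (sqpow x k) = - y"
      by (simp add: y_def power_mult_distrib \<zeta>) (simp add: scC_def)
    then have Q2: "e - Q (l * \<zeta>) * (e + y) \<in> M"
      using Q[of "l * \<zeta>"] l \<zeta> by (simp add: norm_mult)
    have Q1: "e - Q l * (e - y) \<in> M" using Q[OF l] by (simp add: y_def)
    have half: "sc (1/2) (z + z) = z" for z
      by (simp add: sc_add sc_one flip: sc_add_left)
    have "sc (1/2) (e * ((e - Q l * (e - y)) * (e + y) + (e - Q (l * \<zeta>) * (e + y)) * (e - y))) \<in> M"
      by (intro M_closed Q1 Q2)
    also have "e * ((e - Q l * (e - y)) * (e + y) + (e - Q (l * \<zeta>) * (e + y)) * (e - y))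
      = (e + e) - e * ((Q l + Q (l * \<zeta>)) * (e - y * y))"
      by (simp add: normalize)
    also have "sc (1/2) \<dots> = e * (e - Q' l * (e - y * y))"
      by (simp add: Q'_def sc_diff half right_diff_distrib right_unit mult_sc_left mult_sc_right)
    finally show "e * (e - Q' l * (e - sc (l ^ 2 ^ Suc k) (sqpow x (Suc k)))) \<in> M"
      by (simp only: yy)
  qed
  moreover have "p (Q' l - Q' m) \<le> L * cmod (l - m)" if lm: "cmod l \<le> r" "cmod m \<le> r" for l m
  proof -
    have "Q' l - Q' m = sc (1/2) ((Q l - Q m) + (Q (l * \<zeta>) - Q (m * \<zeta>)))"
      by (simp add: Q'_def sc_add sc_diff)
    then have "p (Q' l - Q' m) \<le> 1/2 * p ((Q l - Q m) + (Q (l * \<zeta>) - Q (m * \<zeta>)))"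
      using p_sc[of "1/2" "(Q l - Q m) + (Q (l * \<zeta>) - Q (m * \<zeta>))"] by simp
    also have "\<dots> \<le> 1/2 * (p (Q l - Q m) + p (Q (l * \<zeta>) - Q (m * \<zeta>)))"
      by (intro mult_left_mono p_add) simp
    also have "\<dots> \<le> 1/2 * (L * cmod (l - m) + L * cmod (l * \<zeta> - m * \<zeta>))"
      using lm by (intro mult_left_mono add_mono QL) (auto simp: norm_mult \<zeta>)
    also have "\<dots> = L * cmod (l - m)"
      by (simp add: norm_mult \<zeta> flip: left_diff_distrib)
    finally show ?thesis .
  qed
  ultimately show ?case by blast
qed

text \<open>From one index to the next the quantity is at most squared, so once it is at most 1/2 it
  is at least halved at every step.\<close>

lemma sqpow_tendsto_zero:
  assumes t: "t \<ge> 0"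
    and k: "t ^ 2 ^ k * p (sqpow x k) \<le> 1/2"
  shows "(\<lambda>k. t ^ 2 ^ k * p (sqpow x k)) \<longlonglongrightarrow> 0"
proof -
  define w where "w k = t ^ 2 ^ k * p (sqpow x k)" for k
  have w0: "w k \<ge> 0" for k using t by (simp add: w_def p_nonneg)
  have wS: "w (Suc k) \<le> w k * w k" for k
  proof -
    have "w (Suc k) \<le> t ^ 2 ^ Suc k * (p (sqpow x k) * p (sqpow x k))"
      unfolding w_def by (intro mult_left_mono) (use t p_mult in auto)
    also have "\<dots> = w k * w k"
      by (simp add: w_def mult_2 power_add)
    finally show ?thesis .
  qed
  have wk: "w (n + k) \<le> (1/2) ^ Suc n" for n
  proof (induction n)
    case (Suc n)
    have "w (Suc n + k) \<le> w (n + k) * w (n + k)" using wS by simp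
    also have "\<dots> \<le> (1/2) ^ Suc n * (1/2)"
    proof (intro mult_mono Suc)
      have "(1/2::real) ^ Suc n \<le> (1/2) ^ 1" by (intro power_decreasing) auto
      then show "w (n + k) \<le> 1/2" using Suc by simp
    qed (use w0 in auto)
    finally show ?case by simp
  qed (use k in \<open>simp add: w_def\<close>)
  have "(\<lambda>n. w (n + k)) \<longlonglongrightarrow> 0"
  proof (rule tendsto_sandwich[OF _ _ tendsto_const])
    show "(\<lambda>n. (1/2::real) ^ Suc n) \<longlonglongrightarrow> 0"
      using LIMSEQ_power_zero[of "1/2::real"] by (intro LIMSEQ_Suc) auto
  qed (use w0 wk in auto)
  then have "w \<longlonglongrightarrow> 0" by (rule LIMSEQ_offset)
  then show ?thesis by (simp add: w_def[abs_def])
qed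

text \<open>At \<open>s\<close> the averaged inverse is close to \<open>e\<close>; the Lipschitz
  bound carries this to \<open>t\<close>, where closeness to \<open>e\<close> forces
  \<open>Y t\<close> to be small. The admissible increment depends on \<open>L\<close> and
  \<open>p e\<close> but not on \<open>k\<close>.\<close>

lemma sqpow_radius_step:
  assumes G: "\<And>l. cmod l \<le> r \<Longrightarrow> e - G l * (e - sc l x) \<in> M"
    and lip: "\<And>l m. cmod l \<le> r \<Longrightarrow> cmod m \<le> r \<Longrightarrow> p (G l - G m) \<le> L * cmod (l - m)"
    and st: "0 \<le> s" "s \<le> t" "t \<le> r" "L * (t - s) \<le> 1 / (8 * p e)"
    and s: "(\<lambda>k. s ^ 2 ^ k * p (sqpow x k)) \<longlonglongrightarrow> 0"
  shows "(\<lambda>k. t ^ 2 ^ k * p (sqpow x k)) \<longlonglongrightarrow> 0"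
proof -
  define P where "P = p e"
  have P: "P \<ge> 1" using p_unit_ge_1 by (simp add: P_def)
  \<comment> \<open>This threshold puts \<open>H s\<close> within \<open>1 / (8 * P)\<close> of
    \<open>e\<close>, hence \<open>H t\<close> within \<open>1 / (4 * P)\<close>, which yields
    \<open>W\<close> at most 1/3.\<close>
  have "\<forall>\<^sub>F k in sequentially. s ^ 2 ^ k * p (sqpow x k) < 1 / (16 * P * P)"
    using P by (intro order_tendstoD(2)[OF s]) simp
  then obtain k where k: "s ^ 2 ^ k * p (sqpow x k) < 1 / (16 * P * P)"
    using eventually_sequentially by auto
  obtain Q where
    Q: "\<And>l. cmod l \<le> r \<Longrightarrow> e - Q l * (e - sc (l ^ 2 ^ k) (sqpow x k)) \<in> M" and
    QL: "\<And>l m. cmod l \<le> r \<Longrightarrow> cmod m \<le> r \<Longrightarrow> p (Q l - Q m) \<le> L * cmod (l - m)"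
    using averaged_resolvents[of r G x L k, OF G lip] by blast
  define Y where "Y u = sc (of_real u ^ 2 ^ k) (sqpow x k)" for u :: real
  define H where "H u = Q (of_real u)" for u :: real
  have HY: "e - H u * (e - Y u) \<in> M" if "0 \<le> u" "u \<le> r" for u
    using Q[of "of_real u"] that by (simp add: H_def Y_def)
  have pY: "p (Y u) \<le> u ^ 2 ^ k * p (sqpow x k)" if "u \<ge> 0" for u
    using p_sc[of "of_real u ^ 2 ^ k" "sqpow x k"] that by (simp add: Y_def norm_power)
  have Ys: "p (Y s) \<le> 1 / (16 * P * P)" using pY[OF st(1)] k by simp
  have Hs: "p (H s - e) \<le> 1 / (8 * P)"
  proof -
    define X where "X = p (H s - e)"
    have "- (e - H s * (e - Y s)) \<in> M"
      using M_closed(1)[OF M_closed(6) HY[of s]] st by simp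
    then have "p (H s - e) \<le> p (H s * Y s)"
      by (intro p_cong) (simp add: right_diff_distrib right_unit algebra_simps)
    also have "\<dots> \<le> p (H s) * p (Y s)" by (rule p_mult)
    also have "\<dots> \<le> (P + X) * (1 / (16 * P * P))"
    proof (intro mult_mono Ys p_nonneg)
      show "p (H s) \<le> P + X" using p_add[of e "H s - e"] by (simp add: P_def X_def)
    qed (use P in \<open>auto simp: X_def p_nonneg\<close>)
    finally have "X \<le> (P + X) * (1 / (16 * P * P))" by (simp add: X_def)
    then have *: "X * (16 * P * P) \<le> P + X" using P by (simp add: field_simps)
    have "X \<le> X * (P * P)"
      using P mult_left_mono[of 1 "P * P" X] mult_mono[of 1 P 1 P] by (simp add: X_def p_nonneg)
    with * have "X * (8 * P) * P \<le> 1 * P"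
      using p_nonneg[of "H s - e"] by (simp add: X_def algebra_simps)
    then have "X * (8 * P) \<le> 1" using P by (subst (asm) mult_le_cancel_right) auto
    then show ?thesis using P by (simp add: X_def field_simps)
  qed
  have Ht: "p (H t - e) \<le> 1 / (4 * P)"
  proof -
    have "p (H t - H s) \<le> L * cmod (of_real t - of_real s)"
      unfolding H_def by (rule QL) (use st in auto)
    also have "\<dots> = L * (t - s)" using st by (simp flip: of_real_diff)
    also have "\<dots> \<le> 1 / (8 * P)" using st by (simp add: P_def)
    finally have "p (H t - e) \<le> 1 / (8 * P) + 1 / (8 * P)"
      using p_triangle[of "H t" e "H s"] Hs by simp
    then show ?thesis by simp
  qed
  define W where "W = p (Y t)"
  have W0: "W \<ge> 0" by (simp add: W_def p_nonneg)
  have "W \<le> 1/2"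
  proof -
    \<comment> \<open>Modulo \<open>M\<close> the product \<open>H t * (e - Y t)\<close> is
      \<open>e\<close>, so only \<open>Y t\<close> is left.\<close>
    have "Y t - (H t - e) * (e - Y t) \<in> M"
    proof (rule M_unitD)
      have "e * (e - H t * (e - Y t)) \<in> M" using st by (intro M_closed HY) auto
      then show "e * (Y t - (H t - e) * (e - Y t)) \<in> M" by (simp add: normalize additive_normalize)
    qed
    then have "W \<le> p ((H t - e) * (e - Y t))" unfolding W_def by (rule p_cong)
    also have "\<dots> \<le> p (H t - e) * p (e - Y t)" by (rule p_mult)
    also have "\<dots> \<le> (1 / (4 * P)) * (P + W)"
    proof (intro mult_mono Ht p_nonneg)
      show "p (e - Y t) \<le> P + W"
        using p_triangle[of e "Y t" 0] p_minus_commute[of 0 "Y t"] by (simp add: P_def W_def)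
    qed (use P in auto)
    finally have "W * (4 * P) \<le> P + W" using P by (simp add: field_simps)
    moreover have "W * 1 \<le> W * P" by (intro mult_left_mono P W0)
    ultimately have "W * P * 3 \<le> 1 * P" by simp
    then have "W * 3 * P \<le> 1 * P" by (simp add: mult_ac)
    then have "W * 3 \<le> 1" using P by (subst (asm) mult_le_cancel_right) auto
    then show ?thesis by simp
  qed
  moreover have "t ^ 2 ^ k * p (sqpow x k) \<le> W"
  proof (cases "t = 0")
    case False
    then have t: "t > 0" using st by simp
    have "sqpow x k = sc (of_real (1 / t ^ 2 ^ k)) (Y t)"
      using t by (simp add: Y_def sc_sc sc_one)
    then have "p (sqpow x k) \<le> 1 / t ^ 2 ^ k * W"
      using p_sc[of "of_real (1 / t ^ 2 ^ k)" "Y t"] t by (simp add: W_def norm_divide norm_power)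
    then show ?thesis using t by (simp add: field_simps)
  qed (use W0 in \<open>simp add: power_0_left\<close>)
  ultimately show ?thesis using st by (intro sqpow_tendsto_zero[of t k]) auto
qed

text \<open>Otherwise \<open>x = R 0\<close> inverts \<open>a\<close>, and \<open>a * R l\<close>
  inverts \<open>e - l x\<close> for every \<open>l\<close>. Finitely many radius steps give
  \<open>r ^ 2 ^ k * p (sqpow x k)\<close> tending to 0, whereas
  \<open>sqpow a k * sqpow x k\<close> being \<open>e\<close> modulo \<open>M\<close> keeps it at
  least 1.\<close>

theorem gelfand_mazur: "\<exists>l. a - sc l e \<in> M"
proof (rule ccontr)
  assume "\<not> ?thesis"
  then have "\<forall>l. \<exists>y. e - y * (a - sc l e) \<in> M" using inverse_ex by blast
  then obtain R where R: "\<And>l. e - R l * (a - sc l e) \<in> M" by metis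
  define r where "r = norm a + 1"
  obtain K where K: "K > 0" "\<And>l. cmod l \<le> r \<Longrightarrow> p (R l) \<le> K"
    and lip: "\<And>l m. p (R l - R m) \<le> cmod (l - m) * (p (R l) * p (R m))"
    using resolvent_bounded_on_disc[OF R, of r] by (auto simp: r_def)
  define x where "x = R 0"
  define G where "G l = a * R l" for l
  define L where "L = p a * (K * K) + 1"
  have ax: "e - a * x \<in> M"
  proof (rule M_unitD)
    have "e * (e - R 0 * (a - sc 0 e)) \<in> M" by (intro M_closed R)
    then show "e * (e - a * x) \<in> M" by (simp add: x_def normalize)
  qed
  have G: "e - G l * (e - sc l x) \<in> M" for l
  proof (rule M_unitD)
    have "e * ((e - R l * (a - sc l e)) - sc l (R l * (e - a * x))) \<in> M" by (intro M_closed R ax)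
    then show "e * (e - G l * (e - sc l x)) \<in> M"
      by (simp add: G_def normalize mult_sc_left mult_sc_right sc_diff additive_normalize)
  qed
  have GL: "p (G l - G m) \<le> L * cmod (l - m)" if lm: "cmod l \<le> r" "cmod m \<le> r" for l m
  proof -
    have "p (G l - G m) \<le> p a * p (R l - R m)"
      using p_mult[of a "R l - R m"] by (simp add: G_def right_diff_distrib)
    also have "\<dots> \<le> p a * (cmod (l - m) * (K * K))"
      using lm K by (intro mult_left_mono p_nonneg order_trans[OF lip] mult_mono) (auto simp: p_nonneg)
    also have "\<dots> \<le> L * cmod (l - m)" by (simp add: L_def algebra_simps)
    finally show ?thesis .
  qed
  have L: "L > 0" using K(1) p_nonneg[of a] by (simp add: L_def add_nonneg_pos)
  \<comment> \<open>The largest increment allowed by \<open>sqpow_radius_step\<close>, as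
    \<open>L * h = 1 / (8 * p e)\<close>.\<close>
  define h where "h = 1 / (8 * p e * L)"
  have pe: "p e > 0" using p_unit_ge_1 by simp
  have h: "h > 0" using L pe by (simp add: h_def)
  have steps: "(\<lambda>k. (min r (real n * h)) ^ 2 ^ k * p (sqpow x k)) \<longlonglongrightarrow> 0" for n
  proof (induction n)
    case 0
    have "min r 0 = 0" by (simp add: r_def)
    then show ?case by (simp add: power_0_left)
  next
    case (Suc n)
    show ?case
    proof (rule sqpow_radius_step[OF G GL])
      have "min r (real (Suc n) * h) - min r (real n * h) \<le> h"
        using h by (auto simp: min_def algebra_simps)
      then have "L * (min r (real (Suc n) * h) - min r (real n * h)) \<le> L * h"
        using L by (intro mult_left_mono) auto
      also have "\<dots> = 1 / (8 * p e)" using L by (simp add: h_def)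
      finally show "L * (min r (real (Suc n) * h) - min r (real n * h)) \<le> 1 / (8 * p e)" .
      show "min r (real n * h) \<le> min r (real (Suc n) * h)"
        using h by (auto simp: min_def algebra_simps)
    qed (use Suc h in \<open>auto simp: r_def\<close>)
  qed
  obtain n where "r < real n * h" using reals_Archimedean3[OF h] by blast
  with steps[of n] have lim: "(\<lambda>k. r ^ 2 ^ k * p (sqpow x k)) \<longlonglongrightarrow> 0" by (simp add: min_def)
  have unit: "e - sqpow a k * sqpow x k \<in> M" for k
  proof (induction k)
    case (Suc k)
    show ?case
    proof (rule M_unitD)
      let ?q = "sqpow a k * sqpow x k"
      have "e * ((e - ?q) + ?q * (e - ?q)) \<in> M" by (intro M_closed Suc)
      then show "e * (e - sqpow a (Suc k) * sqpow x (Suc k)) \<in> M" by (simp add: normalize)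
    qed
  qed (use ax in simp)
  have pa: "p (sqpow a k) \<le> r ^ 2 ^ k" for k
  proof (induction k)
    case 0 then show ?case using p_le_norm[of a] by (simp add: r_def)
  next
    case (Suc k)
    have "p (sqpow a (Suc k)) \<le> p (sqpow a k) * p (sqpow a k)" by (simp add: p_mult)
    also have "\<dots> \<le> r ^ 2 ^ k * r ^ 2 ^ k"
      by (intro mult_mono Suc p_nonneg) (simp add: r_def)
    finally show ?case by (simp add: mult_2 power_add)
  qed
  have "1 \<le> r ^ 2 ^ k * p (sqpow x k)" for k
  proof -
    have "1 \<le> p (sqpow a k * sqpow x k)" using p_unit_ge_1 p_cong[OF unit[of k]] by simp
    also have "\<dots> \<le> p (sqpow a k) * p (sqpow x k)" by (rule p_mult)
    also have "\<dots> \<le> r ^ 2 ^ k * p (sqpow x k)" by (intro mult_right_mono pa p_nonneg)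
    finally show ?thesis .
  qed
  then have "1 \<le> (0::real)" by (intro LIMSEQ_le_const[OF lim]) auto
  then show False by simp
qed

end

section \<open>Characters\<close>

context complex_banach_algebra
begin

definition character :: "('a \<Rightarrow> complex) \<Rightarrow> bool" where
  "character \<phi> \<longleftrightarrow> (\<forall>x y. \<phi> (x + y) = \<phi> x + \<phi> y) \<and> (\<forall>x y. \<phi> (x * y) = \<phi> x * \<phi> y) \<and>
     (\<forall>c x. \<phi> (sc c x) = c * \<phi> x) \<and> (\<exists>x. \<phi> x \<noteq> 0)"

lemma character_add: "character \<phi> \<Longrightarrow> \<phi> (x + y) = \<phi> x + \<phi> y"
  and character_mult: "character \<phi> \<Longrightarrow> \<phi> (x * y) = \<phi> x * \<phi> y"
  and character_sc: "character \<phi> \<Longrightarrow> \<phi> (sc c x) = c * \<phi> x"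
  by (simp_all add: character_def)

lemma character_scaleR: "character \<phi> \<Longrightarrow> \<phi> (r *\<^sub>R x) = of_real r * \<phi> x"
  using character_sc[of \<phi> "of_real r" x] by (simp add: sc_of_real)

lemma character_zero: "character \<phi> \<Longrightarrow> \<phi> 0 = 0"
  using character_scaleR[of \<phi> 0 0] by simp

lemma character_diff: "character \<phi> \<Longrightarrow> \<phi> (x - y) = \<phi> x - \<phi> y"
  using character_add[of \<phi> "x - y" y] by simp

lemmas character_simps = character_add character_mult character_sc character_scaleR
  character_zero character_diff

text \<open>Continuity is automatic: otherwise some \<open>y\<close> of norm below 1 has
  \<open>\<phi> y = 1\<close>, and its quasi-inverse gives
  \<open>\<phi> z = 1 + \<phi> z\<close>.\<close>

lemma character_norm_le:
  assumes \<phi>: "character \<phi>"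
  shows "cmod (\<phi> x) \<le> norm x"
proof (rule ccontr)
  assume "\<not> ?thesis"
  then have less: "norm x < cmod (\<phi> x)" by simp
  then have nz: "\<phi> x \<noteq> 0" by auto
  define y where "y = sc (1 / \<phi> x) x"
  have "norm y < 1" using less nz by (simp add: y_def norm_sc norm_divide)
  then obtain z where "z = y + y * z" using neumann_quasi_inverse by metis
  then have "\<phi> z = \<phi> y + \<phi> y * \<phi> z" using \<phi> by (metis character_add character_mult)
  moreover have "\<phi> y = 1" using nz \<phi> by (simp add: y_def character_sc)
  ultimately show False by simp
qed

lemma character_bounded_linear: "character \<phi> \<Longrightarrow> bounded_linear \<phi>"
  by (rule bounded_linear_intro[of _ 1])
     (simp_all add: character_simps character_norm_le scaleR_conv_of_real)

end

context right_unital_algebra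
begin

lemma character_unit: "character \<phi> \<Longrightarrow> \<phi> e = 1"
proof -
  assume \<phi>: "character \<phi>"
  then obtain x where "\<phi> x \<noteq> 0" by (auto simp: character_def)
  moreover have "\<phi> x * \<phi> e = \<phi> x" using \<phi> by (metis character_mult right_unit)
  ultimately show ?thesis by simp
qed

lemma character_rann: "character \<phi> \<Longrightarrow> x \<in> rann \<Longrightarrow> \<phi> x = 0"
  using character_unit[of \<phi>] character_mult[of \<phi> e x] character_zero[of \<phi>] by (simp add: rann_def)

text \<open>The value at \<open>a\<close> is the Gelfand--Mazur scalar. It is unique because
  \<open>e\<close> is not in \<open>M\<close>, and uniqueness gives the algebraic laws.\<close>

lemma maximal_ideal_character:
  assumes "maximal_ideal M"
  obtains \<phi> where "character \<phi>" "\<And>x. x \<in> M \<Longrightarrow> \<phi> x = 0"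
proof -
  interpret maximal_ideal_quotient J e M by unfold_locales (rule assms)
  have "\<forall>a. \<exists>l. a - sc l e \<in> M" using gelfand_mazur by blast
  then obtain \<phi> where \<phi>: "\<And>a. a - sc (\<phi> a) e \<in> M" by metis
  have uniq: "\<phi> a = l" if "a - sc l e \<in> M" for a l
  proof (rule ccontr)
    assume ne: "\<phi> a \<noteq> l"
    have "sc (1 / (\<phi> a - l)) ((a - sc l e) - (a - sc (\<phi> a) e)) \<in> M"
      by (intro M_closed that \<phi>)
    then have "sc (1 / (\<phi> a - l)) (sc (\<phi> a - l) e) \<in> M" by (simp add: sc_diff_left)
    then show False using ne unit_notin by (simp add: sc_sc sc_one)
  qed
  have add: "\<phi> (a + b) = \<phi> a + \<phi> b" for a b
    by (rule uniq) (use M_closed(2)[OF \<phi>[of a] \<phi>[of b]] in \<open>simp add: sc_add_left algebra_simps\<close>)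
  have mult: "\<phi> (a * b) = \<phi> a * \<phi> b" for a b
  proof (rule uniq)
    have "(a - sc (\<phi> a) e) * b + sc (\<phi> a) e * (b - sc (\<phi> b) e) \<in> M"
      by (intro M_closed \<phi>)
    then show "a * b - sc (\<phi> a * \<phi> b) e \<in> M"
      by (simp add: algebra_simps mult_sc_left mult_sc_right sc_sc right_unit)
  qed
  have unit: "\<phi> (sc c e) = c" for c
    by (rule uniq) (simp add: M_closed)
  have "\<phi> (sc c a) = c * \<phi> a" for c a
    using mult[of a "sc c e"] by (simp add: unit mult_sc_right right_unit mult.commute)
  then have "character \<phi>"
    using add mult unit[of 1] unfolding character_def by (metis zero_neq_one)
  moreover have "\<phi> x = 0" if "x \<in> M" for x by (rule uniq) (use that in simp)
  ultimately show thesis by (rule that)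
qed

text \<open>If \<open>y\<close> is not left quasi-regular, \<open>e - y\<close> and
  \<open>rann\<close> generate a proper ideal. A character vanishing on it takes the value 1 at
  \<open>y\<close>, and \<open>y\<close> is built from \<open>x\<close>.\<close>

lemma character_nonzero_if_not_rad:
  assumes "x \<notin> rad"
  obtains \<phi> where "character \<phi>" "\<phi> x \<noteq> 0"
proof -
  obtain b and n :: int where nq: "\<not> left_quasi_regular (of_int n *\<^sub>R x + b * x)"
    using assms by (auto simp: rad_def)
  define y where "y = of_int n *\<^sub>R x + b * x"
  define I where "I = {c * (e - y) + r | c r. r \<in> rann}"
  have "left_ideal (rann :: 'a set)"
    by (auto simp: left_ideal_def rann_def right_diff_distrib mult.assoc[symmetric])
  note ext = left_ideal_extend[OF this, of "e - y", folded I_def]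
  have "e \<notin> I"
  proof
    assume "e \<in> I"
    then obtain c r where cr: "e = c * (e - y) + r" "r \<in> rann" by (auto simp: I_def)
    have "y * e = y * (c * (e - y)) + y * r" by (subst cr(1)) (simp add: distrib_left)
    then have "y = y * (c * (e - y))" using cr(2) by (simp add: rann_def right_unit)
    then have "y = y * c - y * c * y"
      by (simp add: right_diff_distrib mult.assoc[symmetric] right_unit)
    \<comment> \<open>So \<open>- (y * c)\<close> is a left quasi-inverse of
      \<open>y\<close>.\<close>
    then have "- (y * c) + y - (- (y * c)) * y = 0" by (simp add: algebra_simps)
    then show False using nq unfolding left_quasi_regular_def y_def[symmetric] by blast
  qed
  then obtain M where M: "maximal_ideal M" "I \<subseteq> M"
    using maximal_ideal_exists[OF ext(1)] by blast
  obtain \<phi> where \<phi>: "character \<phi>" "\<And>x. x \<in> M \<Longrightarrow> \<phi> x = 0"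
    using maximal_ideal_character[OF M(1)] by blast
  have "\<phi> (e - y) = 0" using \<phi>(2) ext(3) M(2) by blast
  then have "\<phi> y = 1" using \<phi>(1) by (simp add: character_diff character_unit)
  then have "\<phi> x \<noteq> 0" using \<phi>(1) by (auto simp: y_def character_simps)
  with \<phi>(1) show thesis by (rule that)
qed

section \<open>Separation of characters\<close>

lemma character_separation:
  assumes "character \<phi>" "character \<psi>" "\<phi> \<noteq> \<psi>"
  obtains u where "\<phi> u = 0" "\<psi> u = 1"
proof -
  obtain x where x: "\<phi> x \<noteq> \<psi> x" using assms(3) by blast
  show thesis
    by (rule that[of "sc (1 / (\<psi> x - \<phi> x)) (x - sc (\<phi> x) e)"])
       (use x assms in \<open>auto simp: character_simps character_unit\<close>)
qed

lemma character_separation_finite: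
  assumes "finite F" "character \<psi>" "\<psi> \<notin> F" "\<And>\<phi>. \<phi> \<in> F \<Longrightarrow> character \<phi>"
  obtains u where "\<psi> u = 1" "\<And>\<phi>. \<phi> \<in> F \<Longrightarrow> \<phi> u = 0"
proof -
  have "\<exists>u. \<psi> u = 1 \<and> (\<forall>\<phi>\<in>F. \<phi> u = 0)"
    using assms(1,3,4)
  proof (induction F)
    case empty
    then show ?case using character_unit[OF assms(2)] by blast
  next
    case (insert \<phi> F)
    then obtain u where u: "\<psi> u = 1" "\<forall>\<phi>\<in>F. \<phi> u = 0" by auto
    obtain v where v: "\<phi> v = 0" "\<psi> v = 1"
      using character_separation[of \<phi> \<psi>] insert.prems assms(2) by auto
    show ?case
      by (rule exI[of _ "u * v"]) (use u v insert.prems assms(2) in \<open>auto simp: character_mult\<close>)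
  qed
  then show thesis using that by blast
qed

text \<open>Of two elements \<open>u\<close> and \<open>e - u\<close> separating two characters, one is non-zero at infinitely
  many characters; passing to these and iterating gives the sequence.\<close>

lemma separating_sequence:
  assumes inf: "infinite F" and F: "\<And>\<phi>. \<phi> \<in> F \<Longrightarrow> character \<phi>"
  obtains \<phi> :: "nat \<Rightarrow> 'a \<Rightarrow> complex" and c :: "nat \<Rightarrow> 'a"
  where "\<And>n. \<phi> n \<in> F" "\<And>n. \<phi> n (c n) = 0" "\<And>n. norm (c n) \<le> 1"
    "\<And>m n. m < n \<Longrightarrow> \<phi> n (c m) \<noteq> 0"
proof -
  have split: "\<exists>\<phi>\<in>X. \<exists>c. \<phi> c = 0 \<and> norm c \<le> 1 \<and> infinite {\<eta>\<in>X. \<eta> c \<noteq> 0}"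
    if X: "X \<subseteq> F" "infinite X" for X
  proof -
    obtain \<phi> where \<phi>: "\<phi> \<in> X" using infinite_imp_nonempty[OF X(2)] by blast
    moreover obtain \<psi> where \<psi>: "\<psi> \<in> X" "\<phi> \<noteq> \<psi>"
      using X(2) by (metis finite.emptyI finite_insert finite_subset insert_iff subsetI)
    ultimately obtain u where u: "\<phi> u = 0" "\<psi> u = 1"
      using character_separation[of \<phi> \<psi>] F X(1) by blast
    have ch: "\<eta> \<in> X \<Longrightarrow> character \<eta>" for \<eta> using F X(1) by blast
    have "X \<subseteq> {\<eta>\<in>X. \<eta> u \<noteq> 0} \<union> {\<eta>\<in>X. \<eta> (e - u) \<noteq> 0}"
      using ch by (auto simp: character_diff character_unit)
    then have "infinite {\<eta>\<in>X. \<eta> u \<noteq> 0} \<or> infinite {\<eta>\<in>X. \<eta> (e - u) \<noteq> 0}"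
      using X(2) by (meson finite_UnI finite_subset)
    then obtain \<phi>' v where v: "\<phi>' \<in> X" "\<phi>' v = 0" "infinite {\<eta>\<in>X. \<eta> v \<noteq> 0}"
    proof
      assume "infinite {\<eta>\<in>X. \<eta> (e - u) \<noteq> 0}"
      moreover have "\<psi> (e - u) = 0" using u \<psi> ch by (simp add: character_diff character_unit)
      ultimately show thesis using \<psi>(1) that by blast
    qed (use u \<phi> that in blast)
    define t where "t = 1 / (norm v + 1)"
    have t: "t > 0" by (simp add: t_def add_nonneg_pos)
    have "norm (t *\<^sub>R v) \<le> 1" using t by (simp add: t_def)
    moreover have "\<phi>' (t *\<^sub>R v) = 0" using v ch by (simp add: character_scaleR)
    moreover have "{\<eta>\<in>X. \<eta> (t *\<^sub>R v) \<noteq> 0} = {\<eta>\<in>X. \<eta> v \<noteq> 0}"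
      using t ch by (auto simp: character_scaleR)
    ultimately show ?thesis
      using v by (intro bexI[of _ \<phi>'] exI[of _ "t *\<^sub>R v"]) simp_all
  qed
  \<comment> \<open>A state is an infinite set of characters, one member \<open>\<phi>\<close>, and
    an element \<open>c\<close> in its kernel. The next set keeps the characters not vanishing at
    \<open>c\<close>, so all later characters are non-zero there.\<close>
  define P where "P = (\<lambda>(X, \<phi>, c). X \<subseteq> F \<and> infinite X \<and> \<phi> \<in> X \<and> \<phi> c = 0 \<and> norm c \<le> 1 \<and>
    infinite {\<eta>\<in>X. \<eta> c \<noteq> (0::complex)})"
  have "\<exists>f. \<forall>n. P (f n) \<and> fst (f (Suc n)) = {\<eta>\<in>fst (f n). \<eta> (snd (snd (f n))) \<noteq> 0}"
  proof (rule dependent_nat_choice[where P = "\<lambda>_. P" and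
        Q = "\<lambda>_ x y. fst y = {\<eta>\<in>fst x. \<eta> (snd (snd x)) \<noteq> 0}"])
    have ex: "\<exists>y. P y \<and> fst y = X" if "X \<subseteq> F" "infinite X" for X
    proof -
      from split[OF that] obtain \<phi> where "\<phi> \<in> X"
        and "\<exists>c. \<phi> c = 0 \<and> norm c \<le> 1 \<and> infinite {\<eta>\<in>X. \<eta> c \<noteq> 0}" by (rule bexE)
      moreover from this(2) obtain c where "\<phi> c = 0 \<and> norm c \<le> 1 \<and> infinite {\<eta>\<in>X. \<eta> c \<noteq> 0}"
        by (rule exE)
      ultimately show ?thesis using that by (intro exI[of _ "(X, \<phi>, c)"]) (simp add: P_def)
    qed
    show "\<exists>x. P x" using ex[OF subset_refl inf] by blast
    fix x assume "P x"
    then have "{\<eta>\<in>fst x. \<eta> (snd (snd x)) \<noteq> 0} \<subseteq> F" "infinite {\<eta>\<in>fst x. \<eta> (snd (snd x)) \<noteq> 0}"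
      by (auto simp: P_def split: prod.splits)
    then show "\<exists>y. P y \<and> fst y = {\<eta>\<in>fst x. \<eta> (snd (snd x)) \<noteq> 0}" by (rule ex)
  qed
  then obtain f where f: "\<And>n. P (f n)"
    "\<And>n. fst (f (Suc n)) = {\<eta>\<in>fst (f n). \<eta> (snd (snd (f n))) \<noteq> 0}" by blast
  define \<phi> where "\<phi> n = fst (snd (f n))" for n
  define c where "c n = snd (snd (f n))" for n
  have mem: "\<phi> n \<in> fst (f n)" "fst (f n) \<subseteq> F" "\<phi> n (c n) = 0" "norm (c n) \<le> 1" for n
    using f(1)[of n] by (auto simp: P_def \<phi>_def c_def split: prod.splits)
  have dec: "fst (f n) \<subseteq> fst (f m)" if "m \<le> n" for m n
    by (rule lift_Suc_antimono_le[OF _ that]) (use f(2) in auto)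
  have "\<phi> n (c m) \<noteq> 0" if "m < n" for m n
    using mem(1)[of n] dec[of "Suc m" n] f(2)[of m] that by (auto simp: c_def)
  then show thesis using subsetD[OF mem(2) mem(1)] mem(3,4) by (intro that[of \<phi> c])
qed

end

section \<open>Derivations\<close>

locale semisimple_derivation = right_unital_algebra J e
  for J :: "'a::{real_normed_algebra,banach} \<Rightarrow> 'a" and e +
  fixes d :: "'a \<Rightarrow> 'a"
  assumes rad_eq_rann: "(rad :: 'a set) = rann"
    and derivation: "is_derivation J d"
begin

lemma d_linear: "linear d" and d_J: "d (J x) = J (d x)" and d_mult: "d (x * y) = d x * y + x * d y"
  using derivation by (auto simp: is_derivation_def clinear_J_def)

lemmas d_simps = linear_add[OF d_linear] linear_diff[OF d_linear] linear_cmul[OF d_linear]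
  linear_0[OF d_linear]

lemma d_sc: "d (sc c x) = sc c (d x)"
  by (simp add: scC_def d_simps d_J)

text \<open>Semisimplicity of the quotient enters here: identities modulo \<open>rann\<close> can be
  checked at each character.\<close>

lemma rann_iff_characters: "x \<in> rann \<longleftrightarrow> (\<forall>\<phi>. character \<phi> \<longrightarrow> \<phi> x = 0)"
  using character_rann character_nonzero_if_not_rad[of x] rad_eq_rann by blast

text \<open>Hence \<open>d\<close> respects congruence modulo \<open>rann\<close>.\<close>

lemma d_rann: "x \<in> rann \<Longrightarrow> d x \<in> rann"
  using d_mult[of _ x] by (auto simp: rann_def d_simps)

lemma character_d_mult: "character \<phi> \<Longrightarrow> \<phi> (d (x * y)) = \<phi> (d x) * \<phi> y + \<phi> x * \<phi> (d y)"
  by (simp add: d_mult character_simps)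

section \<open>Automatic continuity modulo the radical\<close>

definition separating_space :: "'a set" where
  "separating_space = {s. \<exists>y. y \<longlonglongrightarrow> 0 \<and> (\<lambda>n. d (y n)) \<longlonglongrightarrow> s}"

lemma separating_space_mult:
  assumes "s \<in> separating_space"
  shows "s * b \<in> separating_space"
proof -
  obtain y where y: "y \<longlonglongrightarrow> 0" "(\<lambda>n. d (y n)) \<longlonglongrightarrow> s"
    using assms by (auto simp: separating_space_def)
  have "(\<lambda>n. y n * b) \<longlonglongrightarrow> 0 * b" by (intro tendsto_intros y)
  moreover have "(\<lambda>n. d (y n) * b + y n * d b) \<longlonglongrightarrow> s * b + 0 * d b" by (intro tendsto_intros y)
  ultimately show ?thesis
    unfolding separating_space_def by (auto intro!: exI[of _ "\<lambda>n. y n * b"] simp: d_mult)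
qed

text \<open>Along a null sequence \<open>\<phi> (d (y n))\<close> stays away from 0, so a large
  multiple of a late term is still small while its image is large.\<close>

lemma separating_space_unbounded:
  assumes \<phi>: "character \<phi>" and s: "s \<in> separating_space" "\<phi> s \<noteq> 0" and \<epsilon>: "\<epsilon> > 0"
  obtains y where "norm y \<le> \<epsilon>" "cmod (\<phi> (d y)) \<ge> B"
proof -
  obtain y where y: "y \<longlonglongrightarrow> 0" "(\<lambda>n. d (y n)) \<longlonglongrightarrow> s"
    using s by (auto simp: separating_space_def)
  define b where "b = cmod (\<phi> s) / 2"
  have b: "b > 0" using s by (simp add: b_def)
  define t where "t = \<bar>B\<bar> / b + 1"
  have t: "t > 0" "t * b \<ge> B" using b by (auto simp: t_def algebra_simps intro: add_pos_nonneg)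
  have "(\<lambda>n. cmod (\<phi> (d (y n)))) \<longlonglongrightarrow> cmod (\<phi> s)"
    by (intro tendsto_norm bounded_linear.tendsto[OF character_bounded_linear[OF \<phi>]] y)
  then have "\<forall>\<^sub>F n in sequentially. b < cmod (\<phi> (d (y n)))"
    using b by (intro order_tendstoD(1)) (auto simp: b_def)
  moreover have "\<forall>\<^sub>F n in sequentially. norm (y n) < \<epsilon> / t"
    using tendsto_norm[OF y(1)] \<epsilon> t by (intro order_tendstoD(2)) auto
  ultimately have "\<forall>\<^sub>F n in sequentially. b < cmod (\<phi> (d (y n))) \<and> norm (y n) < \<epsilon> / t"
    by (rule eventually_conj)
  then obtain n where n: "b < cmod (\<phi> (d (y n)))" "norm (y n) < \<epsilon> / t"
    using eventually_sequentially by auto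
  show thesis
  proof (rule that[of "t *\<^sub>R y n"])
    show "norm (t *\<^sub>R y n) \<le> \<epsilon>" using n(2) t by (simp add: field_simps)
    have "t * b \<le> t * cmod (\<phi> (d (y n)))" using n t by (intro mult_left_mono) auto
    then show "cmod (\<phi> (d (t *\<^sub>R y n))) \<ge> B"
      using t order_trans[OF t(2)] by (simp add: d_simps character_scaleR[OF \<phi>] norm_mult)
  qed
qed

text \<open>A gliding hump: in \<open>x = \<Sum>n. P n * y n\<close> with \<open>P n = c 0 * \<dots> * c (n - 1)\<close>, the terms after the
  \<open>n\<close>-th lie in the multiples of \<open>P (Suc n)\<close>, on which \<open>\<phi> n \<circ> d\<close> is bounded because \<open>\<phi> n\<close>
  vanishes at \<open>c n\<close>.\<close>
lemma finite_discontinuity_characters: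
  "finite {\<phi>. character \<phi> \<and> (\<exists>s\<in>separating_space. \<phi> s \<noteq> 0)}" (is "finite ?F")
proof (rule ccontr)
  assume "infinite ?F"
  then obtain \<phi> :: "nat \<Rightarrow> 'a \<Rightarrow> complex" and c
    where F: "\<And>n. \<phi> n \<in> ?F" and c0: "\<And>n. \<phi> n (c n) = 0" and cn: "\<And>n. norm (c n) \<le> 1"
    and c1: "\<And>m n. m < n \<Longrightarrow> \<phi> n (c m) \<noteq> 0"
    by (rule separating_sequence) auto
  have \<phi>: "character (\<phi> n)" for n using F[of n] by simp
  \<comment> \<open>\<open>q m i\<close> is the product of \<open>c m\<close> up to
    \<open>c (m + i - 1)\<close>, started at \<open>e\<close>, so that \<open>P m\<close> splits off
    on the left of \<open>P (i + m)\<close>.\<close>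
  define q where "q m i = rec_nat e (\<lambda>i z. z * c (m + i)) i" for m i
  have q0: "q m 0 = e" and qS: "q m (Suc i) = q m i * c (m + i)" for m i by (simp_all add: q_def)
  have qn: "norm (q m i) \<le> norm e" for m i
  proof (induction i)
    case (Suc i)
    have "norm (q m (Suc i)) \<le> norm (q m i) * norm (c (m + i))" by (simp add: qS norm_mult_ineq)
    also have "\<dots> \<le> norm (q m i) * 1" by (intro mult_left_mono cn) simp
    finally show ?case using Suc by simp
  qed (simp add: q0)
  define P where "P = q 0"
  have P_split: "P (i + m) = P m * q m i" for i m
    by (induction i) (simp_all add: P_def q0 qS right_unit mult.assoc add.commute)
  have P_nz: "\<phi> n (P m) \<noteq> 0" if "m \<le> n" for m n
    using that by (induction m) (auto simp: P_def q0 qS character_simps character_unit \<phi> c1)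
  have P_z: "\<phi> n (P (Suc n)) = 0" for n
    by (simp add: P_def qS character_simps \<phi> c0)
  \<comment> \<open>The \<open>n\<close>-th term must outweigh by \<open>n\<close> both the
    preceding partial sum \<open>s\<close> and the tail \<open>P (Suc n) * w (Suc n)\<close>, where
    \<open>w\<close> has norm at most \<open>2 * norm e\<close>.\<close>
  define B where "B n s = real n + cmod (\<phi> n (d s)) + 2 * norm e * cmod (\<phi> n (d (P (Suc n))))" for n s
  have "\<exists>y. norm y \<le> (1/2) ^ n \<and> cmod (\<phi> n (d (P n * y))) \<ge> B n s" for n s
  proof -
    define \<alpha> where "\<alpha> = \<phi> n (P n)"
    define \<beta> where "\<beta> = \<phi> n (d (P n))"
    have \<alpha>: "cmod \<alpha> > 0" using P_nz[of n n] by (simp add: \<alpha>_def)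
    obtain s' where "s' \<in> separating_space" "\<phi> n s' \<noteq> 0" using F[of n] by auto
    then obtain y where y: "norm y \<le> (1/2) ^ n" "cmod (\<phi> n (d y)) \<ge> (B n s + cmod \<beta>) / cmod \<alpha>"
      using separating_space_unbounded[OF \<phi>[of n], of s' "(1/2) ^ n"]
      by (metis half_gt_zero zero_less_one zero_less_power)
    have "cmod (\<phi> n y) \<le> 1"
      using character_norm_le[OF \<phi>[of n], of y] y(1) power_le_one[of "1/2::real" n] by simp
    then have "cmod (\<beta> * \<phi> n y) \<le> cmod \<beta> * 1" unfolding norm_mult by (intro mult_left_mono) auto
    moreover have "B n s + cmod \<beta> \<le> cmod (\<alpha> * \<phi> n (d y))"
      using y(2) \<alpha> by (simp add: norm_mult divide_le_eq mult.commute)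
    moreover have "\<phi> n (d (P n * y)) = \<beta> * \<phi> n y + \<alpha> * \<phi> n (d y)"
      by (simp add: character_d_mult \<phi> \<alpha>_def \<beta>_def)
    moreover have "cmod (\<alpha> * \<phi> n (d y)) \<le> cmod (\<beta> * \<phi> n y + \<alpha> * \<phi> n (d y)) + cmod (\<beta> * \<phi> n y)"
      by (metis add.commute add_diff_cancel_left' norm_triangle_ineq4)
    ultimately show ?thesis using y(1) by (intro exI[of _ y]) auto
  qed
  then obtain h where hn: "\<And>n s. norm (h n s) \<le> (1/2) ^ n"
    and hB: "\<And>n s. cmod (\<phi> n (d (P n * h n s))) \<ge> B n s" by metis
  \<comment> \<open>The partial sums come first, because the choice of each term depends on the sum
    of its predecessors.\<close>
  define S where "S = rec_nat 0 (\<lambda>n s. s + P n * h n s)"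
  have S0: "S 0 = 0" and SS: "S (Suc n) = S n + P n * h n (S n)" for n by (simp_all add: S_def)
  define y where "y n = h n (S n)" for n
  have S_sum: "S n = (\<Sum>i<n. P i * y i)" for n
    by (induction n) (simp_all add: S0 SS y_def)
  have geo: "summable (\<lambda>i. norm e * (1/2::real) ^ i)"
    by (intro summable_mult summable_geometric) simp
  have qy: "norm (q m i * y (i + m)) \<le> norm e * (1/2) ^ i" for m i
  proof -
    have "norm (q m i * y (i + m)) \<le> norm (q m i) * norm (y (i + m))" by (rule norm_mult_ineq)
    also have "\<dots> \<le> norm e * (1/2) ^ (i + m)"
      using hn by (intro mult_mono qn) (auto simp: y_def)
    also have "\<dots> \<le> norm e * (1/2) ^ i" by (intro mult_left_mono power_decreasing) auto
    finally show ?thesis .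
  qed
  have smn: "summable (\<lambda>i. norm (q m i * y (i + m)))" for m
    by (rule summable_comparison_test[OF _ geo]) (use qy in auto)
  note sm = summable_norm_cancel[OF smn]
  define w where "w m = (\<Sum>i. q m i * y (i + m))" for m
  have wn: "norm (w m) \<le> 2 * norm e" for m
  proof -
    have "norm (w m) \<le> (\<Sum>i. norm (q m i * y (i + m)))" unfolding w_def by (rule summable_norm[OF smn])
    also have "\<dots> \<le> (\<Sum>i. norm e * (1/2) ^ i)" by (rule suminf_le[OF qy smn geo])
    also have "\<dots> = 2 * norm e" by (subst suminf_mult) (auto simp: suminf_geometric)
    finally show ?thesis .
  qed
  define x where "x = w 0"
  have x_split: "x = S m + P m * w m" for m
  proof -
    have "x = (\<Sum>i. P (i + m) * y (i + m)) + S m"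
      using suminf_split_initial_segment[OF sm[of 0], of m] by (simp add: x_def w_def S_sum P_def)
    also have "(\<Sum>i. P (i + m) * y (i + m)) = P m * w m"
      using suminf_mult[OF sm[of m], of "P m"] by (simp add: P_split w_def mult.assoc)
    finally show ?thesis by simp
  qed
  have "real n \<le> norm (d x)" for n
  proof -
    let ?t = "\<phi> n (d (P (Suc n) * w (Suc n)))"
    have "?t = \<phi> n (d (P (Suc n))) * \<phi> n (w (Suc n))"
      by (simp add: character_d_mult \<phi> P_z)
    then have t: "cmod ?t \<le> 2 * norm e * cmod (\<phi> n (d (P (Suc n))))"
      using mult_left_mono[OF order_trans[OF character_norm_le[OF \<phi>[of n]] wn[of "Suc n"]], of "cmod (\<phi> n (d (P (Suc n))))"]
      by (simp add: norm_mult mult_ac)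
    have "\<phi> n (d x) = \<phi> n (d (S n)) + \<phi> n (d (P n * h n (S n))) + ?t"
      by (subst x_split[of "Suc n"]) (simp add: SS d_simps character_simps \<phi>)
    then have "cmod (\<phi> n (d (P n * h n (S n)))) \<le> cmod (\<phi> n (d x)) + cmod (\<phi> n (d (S n))) + cmod ?t"
      using norm_triangle_ineq4[of "\<phi> n (d x) - \<phi> n (d (S n))" ?t]
        norm_triangle_ineq4[of "\<phi> n (d x)" "\<phi> n (d (S n))"] by simp
    then have "real n \<le> cmod (\<phi> n (d x))" using hB[of n "S n"] t by (simp add: B_def)
    then show ?thesis using character_norm_le[OF \<phi>[of n], of "d x"] by simp
  qed
  then show False by (meson not_le reals_Archimedean2)
qed

text \<open>A character seen by the separating space is isolated by an element of it that is idempotent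
  modulo \<open>rann\<close>, and derivations kill idempotents of commutative algebras.\<close>
lemma separating_space_subset_rann: "separating_space \<subseteq> rann"
proof (rule ccontr)
  define F where "F = {\<phi>. character \<phi> \<and> (\<exists>s\<in>separating_space. \<phi> s \<noteq> 0)}"
  assume "\<not> ?thesis"
  then obtain s0 where "s0 \<in> separating_space" "s0 \<notin> rann" by blast
  then obtain \<psi> where \<psi>F: "\<psi> \<in> F" unfolding F_def rann_iff_characters by blast
  then obtain s where \<psi>: "character \<psi>" and s: "s \<in> separating_space" "\<psi> s \<noteq> 0"
    by (auto simp: F_def)
  obtain u where u: "\<psi> u = 1" "\<And>\<phi>. \<phi> \<in> F - {\<psi>} \<Longrightarrow> \<phi> u = 0"
  proof (rule character_separation_finite)
    show "finite (F - {\<psi>})" using finite_discontinuity_characters by (simp add: F_def)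
  qed (auto simp: F_def \<psi>)
  define b where "b = sc (1 / \<psi> s) u"
  \<comment> \<open>\<open>p\<close> has value 1 at \<open>\<psi>\<close> and 0 at every other
    character: on \<open>F\<close> because of \<open>u\<close>, outside \<open>F\<close> because
    \<open>p\<close> lies in the separating space.\<close>
  define p where "p = s * b"
  have p1: "\<psi> p = 1" using s u \<psi> by (simp add: p_def b_def character_simps)
  have p0: "\<phi> p = 0" if "character \<phi>" "\<phi> \<noteq> \<psi>" for \<phi>
  proof (cases "\<phi> \<in> F")
    case True
    then show ?thesis using u(2)[of \<phi>] that by (simp add: p_def b_def character_simps)
  next
    case False
    then show ?thesis using separating_space_mult[OF s(1), of b] that by (auto simp: F_def p_def)
  qed
  have "p * p - p \<in> rann"
    unfolding rann_iff_characters
  proof (intro allI impI)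
    fix \<phi> assume "character \<phi>"
    then show "\<phi> (p * p - p) = 0"
      by (cases "\<phi> = \<psi>") (simp_all add: character_simps p0 p1)
  qed
  \<comment> \<open>Differentiating \<open>p * p = p\<close> at \<open>\<psi>\<close> gives
    \<open>2 * \<psi> (d p) = \<psi> (d p)\<close>.\<close>
  from character_rann[OF \<psi> d_rann[OF this]] have dp: "\<psi> (d p) = 0"
    by (simp add: d_simps character_simps character_d_mult \<psi> p1)
  \<comment> \<open>Since \<open>p * z\<close> is \<open>\<psi> z\<close> times \<open>p\<close>
    modulo \<open>rann\<close>, differentiating gives \<open>\<psi> (d z) = 0\<close>, which passes
    to the limit \<open>s\<close> and contradicts \<open>\<psi> s \<noteq> 0\<close>.\<close>
  have zero: "\<psi> (d z) = 0" for z
  proof -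
    have "p * z - sc (\<psi> z) p \<in> rann"
      unfolding rann_iff_characters
    proof (intro allI impI)
      fix \<phi> assume "character \<phi>"
      then show "\<phi> (p * z - sc (\<psi> z) p) = 0"
        by (cases "\<phi> = \<psi>") (simp_all add: character_simps p0 p1)
    qed
    from character_rann[OF \<psi> d_rann[OF this]] show ?thesis
      by (simp add: d_simps d_sc character_simps character_d_mult \<psi> p1 dp)
  qed
  obtain y where y: "(\<lambda>n. d (y n)) \<longlonglongrightarrow> s" using s by (auto simp: separating_space_def)
  have "(\<lambda>n. \<psi> (d (y n))) \<longlonglongrightarrow> \<psi> s"
    by (intro bounded_linear.tendsto[OF character_bounded_linear[OF \<psi>]] y)
  then show False using s(2) by (simp add: zero LIMSEQ_const_iff)
qed

text \<open>Left multiplication by \<open>e\<close> picks a representative modulo \<open>rann\<close>; the derivation itself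
  need not be bounded.\<close>
lemma bounded_linear_unit_d: "bounded_linear (\<lambda>x. e * d x)"
proof (rule closed_graph_bounded_linear)
  show "linear (\<lambda>x. e * d x)"
    by (intro linearI) (simp_all add: d_simps distrib_left)
  fix X x y assume X: "X \<longlonglongrightarrow> x" "(\<lambda>n. e * d (X n)) \<longlonglongrightarrow> y"
  define z where "z n = X n - x" for n
  define t where "t = y - e * d x"
  have z: "z \<longlonglongrightarrow> 0" using tendsto_diff[OF X(1) tendsto_const[of x]] by (simp add: z_def[abs_def])
  have ez: "(\<lambda>n. e * d (z n)) \<longlonglongrightarrow> t"
    using tendsto_diff[OF X(2) tendsto_const[of "e * d x"]]
    by (simp add: z_def t_def d_simps right_diff_distrib)
  \<comment> \<open>The limit \<open>t\<close> must be reached by values of \<open>d\<close> itself: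
    \<open>d (e * z n)\<close> differs from \<open>e * d (z n)\<close> only by the null sequence
    \<open>d e * z n\<close>.\<close>
  have "(\<lambda>n. e * z n) \<longlonglongrightarrow> e * 0" by (intro tendsto_intros z)
  moreover have "(\<lambda>n. d (e * z n)) \<longlonglongrightarrow> d e * 0 + t"
    unfolding d_mult by (intro tendsto_intros z ez)
  ultimately have "t \<in> separating_space"
    unfolding separating_space_def by (auto intro!: exI[of _ "\<lambda>n. e * z n"])
  then have "e * t = 0" using separating_space_subset_rann by (auto simp: rann_def)
  moreover have "(\<lambda>n. e * (e * d (z n))) \<longlonglongrightarrow> e * t" by (intro tendsto_intros ez)
  then have "e * t = t"
    using ez LIMSEQ_unique by (simp add: mult.assoc[symmetric] right_unit)
  ultimately show "e * d x = y" by (simp add: t_def)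
qed

section \<open>Iterated derivations at a character\<close>

lemma funpow_d_linear: "linear (d ^^ n)"
proof (induction n)
  case (Suc n)
  then show ?case using linear_compose[OF Suc d_linear] by (simp add: o_def)
qed (simp add: linear_iff)

lemma funpow_d_rann: "x \<in> rann \<Longrightarrow> (d ^^ n) x \<in> rann"
  by (induction n) (auto intro: d_rann)

lemma character_funpow_d_cong:
  assumes \<phi>: "character \<phi>" and xy: "\<And>\<psi>. character \<psi> \<Longrightarrow> \<psi> x = \<psi> y"
  shows "\<phi> ((d ^^ n) x) = \<phi> ((d ^^ n) y)"
proof -
  have "x - y \<in> rann" using xy by (simp add: rann_iff_characters character_diff)
  from character_rann[OF \<phi> funpow_d_rann[OF this]] show ?thesis
    by (simp add: linear_diff[OF funpow_d_linear] character_diff[OF \<phi>])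
qed

text \<open>The bounded operator \<open>D\<close> agrees with \<open>d\<close> modulo
  \<open>rann\<close>, so characters do not distinguish their iterates; as characters are
  contractive, one \<open>K\<close> serves all of them.\<close>

lemma character_funpow_d_bound:
  obtains K where "K \<ge> 0" "\<And>\<phi> n x. character \<phi> \<Longrightarrow> cmod (\<phi> ((d ^^ n) x)) \<le> K ^ n * norm x"
proof -
  define D where "D x = e * d x" for x
  obtain K where K: "K \<ge> 0" "\<And>x. norm (D x) \<le> norm x * K"
    using bounded_linear.nonneg_bounded[OF bounded_linear_unit_d] by (auto simp: D_def)
  have Dn: "norm ((D ^^ n) x) \<le> K ^ n * norm x" for n x
  proof (induction n)
    case (Suc n)
    have "norm ((D ^^ Suc n) x) \<le> norm ((D ^^ n) x) * K" using K by simp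
    also have "\<dots> \<le> K ^ n * norm x * K" by (intro mult_right_mono Suc K)
    finally show ?case by (simp add: mult_ac)
  qed simp
  have rann_add: "u \<in> rann \<Longrightarrow> v \<in> rann \<Longrightarrow> u + v \<in> rann" for u v :: 'a
    by (simp add: rann_def distrib_left)
  have "(d ^^ n) x - (D ^^ n) x \<in> rann" for n x
  proof (induction n)
    case (Suc n)
    have "d ((d ^^ n) x - (D ^^ n) x) + (d ((D ^^ n) x) - e * d ((D ^^ n) x)) \<in> rann"
      by (intro rann_add d_rann Suc diff_unit_mult_in_rann)
    then show ?case by (simp add: d_simps D_def[of "(D ^^ n) x"])
  qed (simp add: rann_def)
  then have eq: "\<phi> ((d ^^ n) x) = \<phi> ((D ^^ n) x)" if "character \<phi>" for \<phi> n x
    using that by (metis character_diff character_rann right_minus_eq)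
  show thesis
  proof (rule that[OF K(1)])
    fix \<phi> n x assume "character \<phi>"
    then show "cmod (\<phi> ((d ^^ n) x)) \<le> K ^ n * norm x"
      using eq order_trans[OF character_norm_le Dn] by metis
  qed
qed

text \<open>Powers of \<open>a\<close> are iterated left multiplications applied to
  \<open>x\<close>, which makes sense for exponent 0 without a two-sided unit.\<close>

lemma character_d_funpow_mult:
  assumes \<psi>: "character \<psi>"
  shows "\<psi> (((*) a ^^ m) x) = \<psi> a ^ m * \<psi> x"
    and "\<psi> (d (((*) a ^^ Suc m) x)) = of_nat (Suc m) * \<psi> a ^ m * \<psi> (d a) * \<psi> x + \<psi> a ^ Suc m * \<psi> (d x)"
proof -
  show *: "\<psi> (((*) a ^^ m) x) = \<psi> a ^ m * \<psi> x" for m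
    by (induction m) (simp_all add: character_mult \<psi>)
  show "\<psi> (d (((*) a ^^ Suc m) x)) = of_nat (Suc m) * \<psi> a ^ m * \<psi> (d a) * \<psi> x + \<psi> a ^ Suc m * \<psi> (d x)"
  proof (induction m)
    case (Suc m)
    have "\<psi> (d (((*) a ^^ Suc (Suc m)) x)) = \<psi> (d a) * (\<psi> a ^ Suc m * \<psi> x) + \<psi> a * \<psi> (d (((*) a ^^ Suc m) x))"
      using *[of "Suc m"] by (simp only: funpow.simps(2)[of "Suc m"] o_apply character_d_mult[OF \<psi>])
    then show ?case unfolding Suc by (simp add: algebra_simps)
  qed (simp add: character_d_mult[OF \<psi>])
qed

text \<open>Induction with varying \<open>x\<close>: the innermost \<open>d\<close> yields
  \<open>Suc m\<close> copies of the case \<open>d a * x\<close> and one case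
  \<open>a * d x\<close>, and the latter vanishes because \<open>\<phi> a = 0\<close>.\<close>

lemma character_funpow_d_power:
  assumes \<phi>: "character \<phi>" and a: "\<phi> a = 0"
  shows "\<phi> ((d ^^ m) (((*) a ^^ m) x)) = fact m * \<phi> (d a) ^ m * \<phi> x"
proof (induction m arbitrary: x)
  case (Suc m)
  have "\<phi> ((d ^^ Suc m) (((*) a ^^ Suc m) x)) = \<phi> ((d ^^ m) (d (((*) a ^^ Suc m) x)))"
    by (simp only: funpow_Suc_right o_apply)
  also have "\<dots> = \<phi> ((d ^^ m) (real (Suc m) *\<^sub>R ((*) a ^^ m) (d a * x) + ((*) a ^^ m) (a * d x)))"
    by (rule character_funpow_d_cong[OF \<phi>], subst character_d_funpow_mult)
       (simp_all add: character_simps character_d_funpow_mult(1) algebra_simps)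
  also have "\<dots> = real (Suc m) * \<phi> ((d ^^ m) (((*) a ^^ m) (d a * x))) + \<phi> ((d ^^ m) (((*) a ^^ m) (a * d x)))"
    by (simp only: linear_add[OF funpow_d_linear] linear_cmul[OF funpow_d_linear] character_simps[OF \<phi>])
  finally show ?case by (simp add: Suc character_mult[OF \<phi>] a algebra_simps)
qed simp

theorem d_in_rann: "d a \<in> rann"
proof -
  obtain K where K: "K \<ge> 0" "\<And>\<phi> n x. character \<phi> \<Longrightarrow> cmod (\<phi> ((d ^^ n) x)) \<le> K ^ n * norm x"
    using character_funpow_d_bound by blast
  have van: "\<phi> (d a) = 0" if \<phi>: "character \<phi>" and a: "\<phi> a = 0" for \<phi> a
  proof (rule ccontr)
    assume nz: "\<phi> (d a) \<noteq> 0"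
    define q where "q = cmod (\<phi> (d a))"
    define C where "C = K * norm a"
    have q: "q > 0" using nz by (simp add: q_def)
    have mn: "norm (((*) a ^^ m) e) \<le> norm a ^ m * norm e" for m
    proof (induction m)
      case (Suc m)
      have "norm (((*) a ^^ Suc m) e) \<le> norm a * norm (((*) a ^^ m) e)" by (simp add: norm_mult_ineq)
      also have "\<dots> \<le> norm a * (norm a ^ m * norm e)" by (intro mult_left_mono Suc) simp
      finally show ?case by simp
    qed simp
    \<comment> \<open>Taking \<open>x = e\<close> above compares the factorial with the geometric
      bound for the iterates.\<close>
    have ge: "1 \<le> (C / q) ^ m / fact m * norm e" for m
    proof -
      have "fact m * q ^ m = cmod (\<phi> ((d ^^ m) (((*) a ^^ m) e)))"
        by (simp add: character_funpow_d_power[OF \<phi> a] q_def norm_mult norm_power character_unit[OF \<phi>])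
      also have "\<dots> \<le> K ^ m * norm (((*) a ^^ m) e)" by (rule K(2)[OF \<phi>])
      also have "\<dots> \<le> K ^ m * (norm a ^ m * norm e)" using K(1) by (intro mult_left_mono mn) simp
      finally have "fact m * q ^ m \<le> C ^ m * norm e" by (simp add: C_def power_mult_distrib mult_ac)
      then show ?thesis using q by (simp add: field_simps power_divide)
    qed
    have "(\<lambda>m. (C / q) ^ m / fact m) \<longlonglongrightarrow> 0"
      using summable_LIMSEQ_zero[OF summable_exp[of "C / q"]] by (simp add: field_simps)
    from tendsto_mult_left_zero[OF this] have "(\<lambda>m. (C / q) ^ m / fact m * norm e) \<longlonglongrightarrow> 0" .
    then have "1 \<le> (0::real)" by (rule LIMSEQ_le_const) (use ge in auto)
    then show False by simp
  qed
  \<comment> \<open>Subtracting \<open>\<phi> a\<close> times \<open>e\<close> reduces to the kernel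
    of \<open>\<phi>\<close>, and \<open>\<phi> (d e) = 0\<close> because
    \<open>e * e = e\<close>.\<close>
  have "\<phi> (d a) = 0" if \<phi>: "character \<phi>" for \<phi>
  proof -
    have "\<phi> (d (a - sc (\<phi> a) e)) = 0"
      by (rule van[OF \<phi>]) (simp add: character_simps character_unit \<phi>)
    moreover have "\<phi> (d e) = 0"
      using character_d_mult[OF \<phi>, of e e] by (simp add: right_unit character_unit[OF \<phi>])
    ultimately show ?thesis by (simp add: d_simps d_sc character_simps[OF \<phi>])
  qed
  then show ?thesis by (simp add: rann_iff_characters)
qed

end

section \<open>The equivalences for generalized derivations\<close>

theorem theorem4p7:
  fixes J :: "'a::{real_normed_algebra,banach} \<Rightarrow> 'a"
    and \<delta> d :: "'a \<Rightarrow> 'a" and k :: nat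
  assumes "complex_banach_structure J"
    and "(rad :: 'a set) = rann"
    and "\<forall>a b::'a. commutator a b \<in> rad"
    and "\<exists>e::'a. \<forall>a. a * e = a"
    and "is_generalized_derivation J \<delta> d"
    and "k \<ge> 1"
  shows "(k_commuting k \<delta> \<longleftrightarrow> k_centralizing k \<delta>)
       \<and> (k_centralizing k \<delta> \<longleftrightarrow> right_multiplier J \<delta>)
       \<and> (right_multiplier J \<delta> \<longleftrightarrow> (\<exists>b. \<delta> = R_mult b))"
proof -
  obtain e :: 'a where e: "\<And>a. a * e = a" using assms(4) by blast
  have rc: "x * y * z = x * z * y" for x y z :: 'a
  proof -
    have "x * (y * z - z * y) = 0"
      using assms(2,3) unfolding commutator_def rann_def by blast
    then show ?thesis by (simp add: right_diff_distrib mult.assoc)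
  qed
  have lin: "clinear_J J \<delta>" and der: "is_derivation J d" and gd: "\<And>a b. \<delta> (a * b) = a * \<delta> b + d a * b"
    using assms(5) by (auto simp: is_generalized_derivation_def)
  interpret semisimple_derivation J e d
    by unfold_locales (use assms(1,2) e rc der in auto)
  define b where "b = \<delta> e"
  have \<delta>: "\<delta> a = a * b + d a" for a using gd[of a e] by (simp add: e b_def)
  have left_d: "x * d a = 0" for x a using d_in_rann[of a] by (simp add: rann_def)
  \<comment> \<open>\<open>a * b\<close> commutes with powers of \<open>a\<close> by
    \<open>right_commute\<close>, and \<open>left_d\<close> removes the product ending in
    \<open>d a\<close>.\<close>
  have commut: "commutator (\<delta> a) (npow a k) = d a * npow a k" for a
  proof -
    have "a * b * npow a k = npow a k * (a * b)"
      using rc[of a b "npow a k"] apow_commute[of a "k - 1"] by (simp add: npow_def mult.assoc[symmetric])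
    then show ?thesis by (simp add: commutator_def \<delta> algebra_simps left_d)
  qed
  have apow_e: "apow e n = e" for n by (induction n) (simp_all add: e)
  have i_ii: "k_centralizing k \<delta>" if "k_commuting k \<delta>"
    using that by (simp add: k_commuting_def k_centralizing_def center_def)
  have ii_d: "d a = 0" if cen: "k_centralizing k \<delta>" for a
  proof -
    have z: "d a * npow a k = 0" for a
    proof -
      \<comment> \<open>An element \<open>c\<close> of both sets satisfies
        \<open>c = c * e = e * c = 0\<close>.\<close>
      have "commutator (\<delta> a) (npow a k) \<in> center" "commutator (\<delta> a) (npow a k) \<in> rann"
        using cen assms(2,3) by (auto simp: k_centralizing_def)
      then show ?thesis unfolding commut center_def rann_def by (metis (mono_tags, lifting) e mem_Collect_eq)
    qed
    have de: "d e = 0" using z[of e] by (simp add: npow_def apow_e e)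
    \<comment> \<open>As \<open>d e = 0\<close>, \<open>d (u n)\<close> is a non-zero multiple of
      \<open>d a\<close>, so \<open>d a\<close> annihilates the \<open>k\<close>-th power of
      \<open>u n\<close>; these powers tend to \<open>e\<close>.\<close>
    define u where "u n = e + (1 / real (Suc n)) *\<^sub>R a" for n
    have "d (u n) = (1 / real (Suc n)) *\<^sub>R d a" for n by (simp add: u_def d_simps de)
    then have zero: "d a * npow (u n) k = 0" for n using z[of "u n"] by simp
    have "u \<longlonglongrightarrow> e + 0 *\<^sub>R a"
      unfolding u_def using LIMSEQ_inverse_real_of_nat by (intro tendsto_intros) (simp add: inverse_eq_divide)
    then have u: "u \<longlonglongrightarrow> e" by simp
    have "(\<lambda>n. apow (u n) m) \<longlonglongrightarrow> apow e m" for m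
      by (induction m) (auto intro!: tendsto_mult u)
    then have "(\<lambda>n. d a * npow (u n) k) \<longlonglongrightarrow> d a * e"
      unfolding npow_def by (intro tendsto_mult tendsto_const) (metis apow_e)
    then show ?thesis by (simp add: zero e LIMSEQ_const_iff)
  qed
  have ii_iii: "right_multiplier J \<delta>" if "k_centralizing k \<delta>"
    using lin gd ii_d[OF that] by (simp add: right_multiplier_def)
  have iii_iv: "\<exists>b. \<delta> = R_mult b" if "right_multiplier J \<delta>"
  proof
    show "\<delta> = R_mult b"
    proof
      fix a
      have "\<delta> (a * e) = a * \<delta> e" using that by (simp add: right_multiplier_def)
      then show "\<delta> a = R_mult b a" by (simp add: e b_def R_mult_def)
    qed
  qed
  have iv_i: "k_commuting k \<delta>" if mult: "\<exists>b. \<delta> = R_mult b"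
  proof -
    obtain b' where b': "\<And>a. \<delta> a = a * b'" using mult unfolding R_mult_def by metis
    \<comment> \<open>\<open>b'\<close> may differ from \<open>b = \<delta> e\<close>, but both give
      the same right multiplication, so \<open>d\<close> vanishes.\<close>
    have "b = e * b'" using b'[of e] by (simp add: b_def)
    then have "a * b = a * b'" for a by (simp add: mult.assoc[symmetric] e)
    then have "d a = 0" for a using \<delta>[of a] b'[of a] by simp
    then show ?thesis by (simp add: k_commuting_def commut)
  qed
  show ?thesis using i_ii ii_iii iii_iv iv_i by blast
qed

end
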